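(* Let $\mathbb{F}$ be an algebraically closed field of characteristic $p>2$, let $\lambda=0\in\mathbb{F}^p$, and let $L_{p,p}^{\lambda}$ be the restricted model filiform Lie superalgebra. Then $\dim H^2_*(L_{p,p}^{\lambda},\mathbb{F})=3p+1$ (restricted cohomology, $\mathbb F$ the $1$-dimensional trivial module), and the cohomology classes of the cocycles $$\{(\varphi,\varphi_* ),\ (0,X^i_* )\mid\varphi\in\Omega^4,\ 1\le i\le p\}$$ form a basis, where $$\Omega^4=\{X^{1,p},\ X^1Y^p,\ \varphi_5,\varphi_7,\ldots,\varphi_{p+2},\ \psi_2,\ldots,\psi_p,\ \phi_2,\phi_4,\ldots,\phi_{p+1}\}$$ and for $i\in\{5,7,\ldots,p+2\}$, $2\le j\le p$ and $k\in\{2,4,\ldots,p+1\}$ $$\varphi_i=\sum_{r=2}^{\lfloor i/2\rfloor}(-1)^rX^{r,i-r},\quad \psi_j=\sum_{s=2}^{j}(-1)^sX^sY^{j-s+1},\quad \phi_k=\sum_{t=1}^{\frac k2-1}(-1)^tY^{t,k-t}+(-1)^{\frac k2}\tfrac12Y^{\frac k2,\frac k2}.$$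
   Context: $L_{p,p}^\lambda$, for $\lambda=(\lambda_1,\ldots,\lambda_p)\in\mathbb F^p$, is the Lie superalgebra with even basis $X_1,\ldots,X_p$, odd basis $Y_1,\ldots,Y_p$, super-brackets $[X_1,X_i]=X_{i+1}$ ($2\le i\le p-1$), $[X_1,Y_j]=Y_{j+1}$ ($1\le j\le p-1$), all other brackets of basis elements (not determined by super-skew-symmetry) being zero, and with $p$-map on the even part $(\sum_{k=1}^pa_kX_k)^{[p]}=(\sum_{k=1}^pa_k^p\lambda_k)X_p$; it is a restricted Lie superalgebra. Cochains with trivial coefficients, $L=L_{p,p}^\lambda$, $|x|$ the parity of $x$: $C^q(L;\mathbb F)=\mathrm{Hom}_{\mathbb F}(\bigwedge^qL,\mathbb F)$, where $\bigwedge^qL$ is the super-exterior power, i.e. $L^{\otimes q}$ modulo the span of the elements $\cdots\otimes x_k\otimes x_{k+1}\otimes\cdots+(-1)^{|x_k||x_{k+1}|}\cdots\otimes x_{k+1}\otimes x_k\otimes\cdots$. For $\varphi\in C^1(L;\mathbb F)$, $d^1\varphi(x,y)=-\varphi([x,y])$; for $\alpha\in C^2(L;\mathbb F)$, $$d^2\alpha(x_1,x_2,x_3)=-\alpha([x_1,x_2],x_3)+(-1)^{|x_2||x_3|}\alpha([x_1,x_3],x_2)-(-1)^{|x_1|(|x_2|+|x_3|)}\alpha([x_2,x_3],x_1).$$ Basis of $C^2(L;\mathbb F)$: $X^{i,j}$ ($1\le i<j\le p$), $X^kY^l$ ($1\le k,l\le p$), $Y^{s,t}$ ($1\le s\le t\le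 p$), where $X^{i,j}(X_i,X_j)=1=-X^{i,j}(X_j,X_i)$; $X^kY^l(X_k,Y_l)=1=-X^kY^l(Y_l,X_k)$; $Y^{s,t}(Y_s,Y_t)=Y^{s,t}(Y_t,Y_s)=1$ for $s<t$ and $Y^{s,s}(Y_s,Y_s)=2$; each vanishes on all other pairs of basis vectors. Restricted cohomology: write $[x_1,\ldots,x_r]=[[\cdots[[x_1,x_2],x_3],\cdots],x_r]$. A map $\omega:L_{\bar0}\to\mathbb F$ has the $*$-property with respect to $\varphi\in C^2(L;\mathbb F)$ if for all $c\in\mathbb F$, $x,y\in L_{\bar0}$: (i) $\omega(cx)=c^p\omega(x)$; (ii) $$\omega(x+y)=\omega(x)+\omega(y)+\sum_{\substack{x_i=x\text{ or }y\\ x_1=x,\ x_2=y}}\frac{1}{\sharp(x)}\varphi([x_1,\ldots,x_{p-1}],x_p),$$ the sum being over sequences $(x_1,\ldots,x_p)$ and $\sharp(x)$ the number of factors $x_i$ equal to $x$. $C^1_*(L;\mathbb F)=C^1(L;\mathbb F)$ and $C^2_*(L;\mathbb F)$ is the space of pairs $(\varphi,\omega)$ with $\varphi\in C^2(L;\mathbb F)$ and $\omega:L_{\bar0}\to\mathbb F$ having the $*$-property w.r.t. $\varphi$. For $\varphi\in C^1_*(L;\mathbb F)$: $d^1_*(\varphi)=(d^1\varphi,\mathrm{ind}^1(\varphi))$ with $\mathrm{ind}^1(\varphi)(x)=\varphi(x^{[p]})$. For $(\alpha,\beta)\in C^2_*(L;\mathbb F)$: $d^2_*(\alpha,\beta)=(d^2\alpha,\mathrm{ind}^2(\alpha,\beta))$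 with $\mathrm{ind}^2(\alpha,\beta)(x,y)=\alpha(x,y^{[p]})-\alpha([x,\underbrace{y,\ldots,y}_{p-1}],y)$ for $x,y\in L_{\bar0}$. $H^2_*(L,\mathbb F)=\mathrm{Ker}\,d^2_*/\mathrm{Im}\,d^1_*$. Notation: $X^k_*:L_{\bar0}\to\mathbb F$ is $X^k_*(\sum_{i=1}^pa_iX_i)=a_k^p$. For $\varphi\in C^2(L;\mathbb F)$, $\varphi_*:L_{\bar0}\to\mathbb F$ denotes the map that vanishes on the basis $X_1,\ldots,X_p$ and has the $*$-property w.r.t. $\varphi$. *)

theory Defs
  imports "Jordan_Normal_Form.VS_Connect" "HOL-Algebra.AbelCoset"
begin

section \<open>The model filiform Lie superalgebra\<close>

text \<open>Elements are coordinate functions on the homogeneous basis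
  \<open>X 1, \<dots>, X p\<close> (even), \<open>Y 1, \<dots>, Y p\<close> (odd).\<close>

datatype gen = X nat | Y nat

type_synonym 'a elt = "gen \<Rightarrow> 'a"

definition gens :: "nat \<Rightarrow> gen set" where
  "gens p = X ` {1..p} \<union> Y ` {1..p}"

fun parity :: "gen \<Rightarrow> nat" where
  "parity (X i) = 0"
| "parity (Y j) = 1"

definition bas :: "gen \<Rightarrow> 'a::zero_neq_one elt" where
  "bas g = (\<lambda>h. if h = g then 1 else 0)"

definition Lpp :: "nat \<Rightarrow> 'a::zero elt set" where
  "Lpp p = {x. \<forall>g. g \<notin> gens p \<longrightarrow> x g = 0}"

definition hom_space :: "nat \<Rightarrow> nat \<Rightarrow> 'a::zero elt set" where
  "hom_space p e = {x \<in> Lpp p. \<forall>g. parity g \<noteq> e \<longrightarrow> x g = 0}"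

abbreviation Leven :: "nat \<Rightarrow> 'a::zero elt set" where
  "Leven p \<equiv> hom_space p 0"

definition hom_part :: "nat \<Rightarrow> 'a::zero elt \<Rightarrow> 'a elt" where
  "hom_part e x = (\<lambda>g. if parity g = e then x g else 0)"

text \<open>The sign-reversed values (second branch for \<open>X, X\<close>, and the clause \<open>Y, X\<close>) are forced by super-skew-symmetry.\<close>

fun gen_bracket :: "nat \<Rightarrow> gen \<Rightarrow> gen \<Rightarrow> 'a::field elt" where
  "gen_bracket p (X i) (X j) =
     (if i = 1 \<and> 2 \<le> j \<and> j \<le> p - 1 then bas (X (j + 1))
      else if j = 1 \<and> 2 \<le> i \<and> i \<le> p - 1 then (\<lambda>g. - bas (X (i + 1)) g)
      else (\<lambda>g. 0))"
| "gen_bracket p (X i) (Y j) =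
     (if i = 1 \<and> 1 \<le> j \<and> j \<le> p - 1 then bas (Y (j + 1)) else (\<lambda>g. 0))"
| "gen_bracket p (Y j) (X i) =
     (if i = 1 \<and> 1 \<le> j \<and> j \<le> p - 1 then (\<lambda>g. - bas (Y (j + 1)) g) else (\<lambda>g. 0))"
| "gen_bracket p (Y i) (Y j) = (\<lambda>g. 0)"

definition bracket :: "nat \<Rightarrow> 'a::field elt \<Rightarrow> 'a elt \<Rightarrow> 'a elt" where
  "bracket p x y = (\<lambda>g. \<Sum>a\<in>gens p. \<Sum>b\<in>gens p. x a * y b * gen_bracket p a b g)"

text \<open>Only the entries \<open>lam 1, \<dots>, lam p\<close> are used.\<close>

definition pmap :: "nat \<Rightarrow> (nat \<Rightarrow> 'a::field) \<Rightarrow> 'a elt \<Rightarrow> 'a elt" where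
  "pmap p lam x = (\<lambda>g. (\<Sum>k=1..p. x (X k) ^ p * lam k) * bas (X p) g)"


section \<open>Cochains with trivial coefficients\<close>

text \<open>Linear forms on the super-exterior square are identified with super-skew-symmetric
  bilinear forms. Every function defined on (tuples of) elements of a subspace is represented
  by its extension by zero, so that equality of functions is equality on the subspace.\<close>

definition C1 :: "nat \<Rightarrow> ('a::field elt \<Rightarrow> 'a) set" where
  "C1 p = {f.
     (\<forall>x\<in>Lpp p. \<forall>y\<in>Lpp p. f (\<lambda>g. x g + y g) = f x + f y) \<and>
     (\<forall>c. \<forall>x\<in>Lpp p. f (\<lambda>g. c * x g) = c * f x) \<and>
     (\<forall>x. x \<notin> Lpp p \<longrightarrow> f x = 0)}"

definition C2 :: "nat \<Rightarrow> ('a::field elt \<Rightarrow> 'a elt \<Rightarrow> 'a) set" where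
  "C2 p = {\<alpha>.
     (\<forall>x. \<alpha> x \<in> C1 p) \<and> (\<forall>y. (\<lambda>x. \<alpha> x y) \<in> C1 p) \<and>
     (\<forall>a\<in>{0,1}. \<forall>b\<in>{0,1}. \<forall>x\<in>hom_space p a. \<forall>y\<in>hom_space p b.
        \<alpha> x y = - ((-1) ^ (a * b) * \<alpha> y x))}"

definition d1 :: "nat \<Rightarrow> ('a::field elt \<Rightarrow> 'a) \<Rightarrow> 'a elt \<Rightarrow> 'a elt \<Rightarrow> 'a" where
  "d1 p f = (\<lambda>x y. if x \<in> Lpp p \<and> y \<in> Lpp p then - f (bracket p x y) else 0)"

text \<open>The defining formula of \<open>d2\<close> refers to parities; it is stated for homogeneous
  arguments and extended trilinearly through the homogeneous components.\<close>

definition d2_hom ::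
  "nat \<Rightarrow> ('a::field elt \<Rightarrow> 'a elt \<Rightarrow> 'a) \<Rightarrow> nat \<Rightarrow> nat \<Rightarrow> nat \<Rightarrow> 'a elt \<Rightarrow> 'a elt \<Rightarrow> 'a elt \<Rightarrow> 'a" where
  "d2_hom p \<alpha> e1 e2 e3 x1 x2 x3 =
     - \<alpha> (bracket p x1 x2) x3
     + (-1) ^ (e2 * e3) * \<alpha> (bracket p x1 x3) x2
     - (-1) ^ (e1 * (e2 + e3)) * \<alpha> (bracket p x2 x3) x1"

definition d2 ::
  "nat \<Rightarrow> ('a::field elt \<Rightarrow> 'a elt \<Rightarrow> 'a) \<Rightarrow> 'a elt \<Rightarrow> 'a elt \<Rightarrow> 'a elt \<Rightarrow> 'a" where
  "d2 p \<alpha> = (\<lambda>x1 x2 x3. if x1 \<in> Lpp p \<and> x2 \<in> Lpp p \<and> x3 \<in> Lpp p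
     then \<Sum>e1\<in>{0,1}. \<Sum>e2\<in>{0,1}. \<Sum>e3\<in>{0,1}.
       d2_hom p \<alpha> e1 e2 e3 (hom_part e1 x1) (hom_part e2 x2) (hom_part e3 x3)
     else 0)"


section \<open>Restricted cochains and restricted cohomology\<close>

fun nbracket :: "nat \<Rightarrow> 'a::field elt list \<Rightarrow> 'a elt" where
  "nbracket p [] = (\<lambda>g. 0)"
| "nbracket p (x # xs) = foldl (bracket p) x xs"

text \<open>Sequences with entries \<open>x\<close> or \<open>y\<close> are formal words (so that the sum
  is also right for \<open>x = y\<close>): a Boolean list \<open>w\<close> of length \<open>p\<close>,
  with \<open>True\<close> for \<open>x\<close> and \<open>False\<close> for \<open>y\<close>.\<close>

definition star_sum ::
  "nat \<Rightarrow> ('a::field elt \<Rightarrow> 'a elt \<Rightarrow> 'a) \<Rightarrow> 'a elt \<Rightarrow> 'a elt \<Rightarrow> 'a" where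
  "star_sum p \<phi> x y =
     (\<Sum>w | length w = p \<and> w ! 0 = True \<and> w ! 1 = False.
        let v = map (\<lambda>b. if b then x else y) w in
        1 / of_nat (count_list w True) * \<phi> (nbracket p (take (p - 1) v)) (v ! (p - 1)))"

definition star_property ::
  "nat \<Rightarrow> ('a::field elt \<Rightarrow> 'a elt \<Rightarrow> 'a) \<Rightarrow> ('a elt \<Rightarrow> 'a) \<Rightarrow> bool" where
  "star_property p \<phi> \<omega> \<longleftrightarrow>
     (\<forall>c. \<forall>x\<in>Leven p. \<omega> (\<lambda>g. c * x g) = c ^ p * \<omega> x) \<and>
     (\<forall>x\<in>Leven p. \<forall>y\<in>Leven p. \<omega> (\<lambda>g. x g + y g) = \<omega> x + \<omega> y + star_sum p \<phi> x y)"

type_synonym 'a rcochain2 = "('a elt \<Rightarrow> 'a elt \<Rightarrow> 'a) \<times> ('a elt \<Rightarrow> 'a)"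

definition C2_star :: "nat \<Rightarrow> 'a::field rcochain2 set" where
  "C2_star p = {(\<phi>, \<omega>). \<phi> \<in> C2 p \<and> star_property p \<phi> \<omega> \<and> (\<forall>x. x \<notin> Leven p \<longrightarrow> \<omega> x = 0)}"

definition ind1 :: "nat \<Rightarrow> (nat \<Rightarrow> 'a::field) \<Rightarrow> ('a elt \<Rightarrow> 'a) \<Rightarrow> 'a elt \<Rightarrow> 'a" where
  "ind1 p lam f = (\<lambda>x. if x \<in> Leven p then f (pmap p lam x) else 0)"

definition d1_star :: "nat \<Rightarrow> (nat \<Rightarrow> 'a::field) \<Rightarrow> ('a elt \<Rightarrow> 'a) \<Rightarrow> 'a rcochain2" where
  "d1_star p lam f = (d1 p f, ind1 p lam f)"

definition ind2 :: "nat \<Rightarrow> (nat \<Rightarrow> 'a::field) \<Rightarrow> 'a rcochain2 \<Rightarrow> 'a elt \<Rightarrow> 'a elt \<Rightarrow> 'a" where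
  "ind2 p lam = (\<lambda>(\<alpha>, \<beta>) x y. if x \<in> Leven p \<and> y \<in> Leven p
     then \<alpha> x (pmap p lam y) - \<alpha> (nbracket p (x # replicate (p - 1) y)) y
     else 0)"

definition d2_star :: "nat \<Rightarrow> (nat \<Rightarrow> 'a::field) \<Rightarrow> 'a rcochain2 \<Rightarrow>
    ('a elt \<Rightarrow> 'a elt \<Rightarrow> 'a elt \<Rightarrow> 'a) \<times> ('a elt \<Rightarrow> 'a elt \<Rightarrow> 'a)" where
  "d2_star p lam c = (d2 p (fst c), ind2 p lam c)"

definition Ker_d2_star :: "nat \<Rightarrow> (nat \<Rightarrow> 'a::field) \<Rightarrow> 'a rcochain2 set" where
  "Ker_d2_star p lam = {c \<in> C2_star p. d2_star p lam c = (\<lambda>x y z. 0, \<lambda>x y. 0)}"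

definition Im_d1_star :: "nat \<Rightarrow> (nat \<Rightarrow> 'a::field) \<Rightarrow> 'a rcochain2 set" where
  "Im_d1_star p lam = d1_star p lam ` C1 p"

text \<open>The multiplicative fields of a \<open>module\<close> record have no meaning for a module.\<close>

definition C2_star_space :: "nat \<Rightarrow> ('a::field, 'a rcochain2) module" where
  "C2_star_space p =
     \<lparr>carrier = C2_star p, mult = undefined, one = undefined,
      zero = (\<lambda>x y. 0, \<lambda>x. 0),
      add = (\<lambda>(\<phi>, \<omega>) (\<phi>', \<omega>'). (\<lambda>x y. \<phi> x y + \<phi>' x y, \<lambda>x. \<omega> x + \<omega>' x)),
      smult = (\<lambda>c (\<phi>, \<omega>). (\<lambda>x y. c * \<phi> x y, \<lambda>x. c * \<omega> x))\<rparr>"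

definition quotient_module :: "('a, 'b) module \<Rightarrow> 'b set \<Rightarrow> ('a, 'b set) module" where
  "quotient_module M N =
     \<lparr>carrier = a_rcosets\<^bsub>M\<^esub> N, mult = undefined, one = undefined,
      zero = N, add = set_add M,
      smult = (\<lambda>c A. \<Union>v\<in>A. N +>\<^bsub>M\<^esub> (c \<odot>\<^bsub>M\<^esub> v))\<rparr>"

definition H2_star :: "nat \<Rightarrow> (nat \<Rightarrow> 'a::field) \<Rightarrow> ('a, 'a rcochain2 set) module" where
  "H2_star p lam =
     quotient_module (C2_star_space p\<lparr>carrier := Ker_d2_star p lam\<rparr>) (Im_d1_star p lam)"

definition coh_class :: "nat \<Rightarrow> (nat \<Rightarrow> 'a::field) \<Rightarrow> 'a rcochain2 \<Rightarrow> 'a rcochain2 set" where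
  "coh_class p lam c = Im_d1_star p lam +>\<^bsub>C2_star_space p\<^esub> c"


section \<open>The cochains in the statement\<close>

definition bilinear_ext :: "nat \<Rightarrow> (gen \<Rightarrow> gen \<Rightarrow> 'a::field) \<Rightarrow> 'a elt \<Rightarrow> 'a elt \<Rightarrow> 'a" where
  "bilinear_ext p c = (\<lambda>x y. if x \<in> Lpp p \<and> y \<in> Lpp p
     then \<Sum>a\<in>gens p. \<Sum>b\<in>gens p. x a * y b * c a b else 0)"

definition XX :: "nat \<Rightarrow> nat \<Rightarrow> nat \<Rightarrow> 'a::field elt \<Rightarrow> 'a elt \<Rightarrow> 'a" where
  "XX p i j = bilinear_ext p (\<lambda>a b.
     if a = X i \<and> b = X j then 1 else if a = X j \<and> b = X i then -1 else 0)"

definition XY :: "nat \<Rightarrow> nat \<Rightarrow> nat \<Rightarrow> 'a::field elt \<Rightarrow> 'a elt \<Rightarrow> 'a" where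
  "XY p k l = bilinear_ext p (\<lambda>a b.
     if a = X k \<and> b = Y l then 1 else if a = Y l \<and> b = X k then -1 else 0)"

definition YY :: "nat \<Rightarrow> nat \<Rightarrow> nat \<Rightarrow> 'a::field elt \<Rightarrow> 'a elt \<Rightarrow> 'a" where
  "YY p s t = bilinear_ext p (\<lambda>a b.
     if a = Y s \<and> b = Y t \<or> a = Y t \<and> b = Y s then (if s = t then 2 else 1) else 0)"

definition varphi_c :: "nat \<Rightarrow> nat \<Rightarrow> 'a::field elt \<Rightarrow> 'a elt \<Rightarrow> 'a" where
  "varphi_c p i = (\<lambda>x y. \<Sum>r=2..i div 2. (-1) ^ r * XX p r (i - r) x y)"

definition psi_c :: "nat \<Rightarrow> nat \<Rightarrow> 'a::field elt \<Rightarrow> 'a elt \<Rightarrow> 'a" where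
  "psi_c p j = (\<lambda>x y. \<Sum>s=2..j. (-1) ^ s * XY p s (j - s + 1) x y)"

definition phi_c :: "nat \<Rightarrow> nat \<Rightarrow> 'a::field elt \<Rightarrow> 'a elt \<Rightarrow> 'a" where
  "phi_c p k = (\<lambda>x y. (\<Sum>t=1..k div 2 - 1. (-1) ^ t * YY p t (k - t) x y)
      + (-1) ^ (k div 2) * (1 / 2) * YY p (k div 2) (k div 2) x y)"

definition Omega4 :: "nat \<Rightarrow> ('a::field elt \<Rightarrow> 'a elt \<Rightarrow> 'a) set" where
  "Omega4 p = {XX p 1 p, XY p 1 p}
     \<union> varphi_c p ` {i. odd i \<and> 5 \<le> i \<and> i \<le> p + 2}
     \<union> psi_c p ` {2..p}
     \<union> phi_c p ` {k. even k \<and> 2 \<le> k \<and> k \<le> p + 1}"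

definition star_of :: "nat \<Rightarrow> ('a::field elt \<Rightarrow> 'a elt \<Rightarrow> 'a) \<Rightarrow> 'a elt \<Rightarrow> 'a" where
  "star_of p \<phi> = (THE \<omega>. star_property p \<phi> \<omega> \<and> (\<forall>i\<in>{1..p}. \<omega> (bas (X i)) = 0)
     \<and> (\<forall>x. x \<notin> Leven p \<longrightarrow> \<omega> x = 0))"

definition X_star :: "nat \<Rightarrow> nat \<Rightarrow> 'a::field elt \<Rightarrow> 'a" where
  "X_star p k = (\<lambda>x. if x \<in> Leven p then x (X k) ^ p else 0)"

definition cocycle_list :: "nat \<Rightarrow> 'a::field rcochain2 set" where
  "cocycle_list p = {(\<phi>, star_of p \<phi>) | \<phi>. \<phi> \<in> Omega4 p} \<union> {(\<lambda>x y. 0, X_star p i) | i. i \<in> {1..p}}"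

end

theory Submission
  imports Defs
begin

text \<open>Write \<open>D = ad X\<^sub>1\<close>. The bracket is \<open>[x, y] = x\<^sub>1 D y - y\<^sub>1 D x\<close>, so a \<open>2\<close>-cochain is a cocycle iff its
  restriction to the superabelian ideal spanned by the other generators is \<open>D\<close>-invariant. On that
  ideal the entries of an invariant form alternate in sign along antidiagonals and vanish on the
  antidiagonals that are too long, so the form is determined by its first rows; what remains of a
  cocycle is a coboundary except for its values at \<open>(X\<^sub>1, X\<^sub>p)\<close> and \<open>(X\<^sub>1, Y\<^sub>p)\<close>. Since \<open>\<lambda> = 0\<close> and
  \<open>D\<close> is nilpotent, \<open>ind\<^sup>2\<close> vanishes identically and a coboundary has zero second component, while two
  maps with the star property for the same form differ by a \<open>p\<close>-semilinear map. These first-row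
  entries, together with the values \<open>\<omega>(X\<^sub>i)\<close>, are linear functionals on the restricted cocycles whose
  common kernel is the space of coboundaries and which are dual to the listed cocycles.\<close>

subsection \<open>Dual families and quotient spaces\<close>

text \<open>The listed classes are never compared with one another: duality together with the
  description of the coboundaries as a common kernel yields independence, spanning, distinctness and
  dimension at once. The dimension is 2 + (p-1)/2 + (p-1) + (p+1)/2 + p = 3p + 1, counting the two
  values at \<open>X 1\<close>, the free first-row entries of the XX, XY and YY blocks, and p values
  of \<open>\<omega>\<close>. The halves come from the symmetry of the XX and YY blocks, which
  cancels every second antidiagonal because 2 is invertible.

  The main obstacle is \<open>star_of\<close>: a definite description says nothing until a map with
  the star property is exhibited. An iterated bracket of p - 1 even elements, as it occurs in the
  star sum, is a multiple of X_p, so this sum sees a form only through its values at (X_p, x). When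
  these depend on just two coordinates of x, the property becomes a polynomial identity that can be
  solved explicitly, and every listed form is of this kind. For an arbitrary cocycle existence is
  never at issue, since its second component is given; uniqueness is enough there.\<close>

lemma (in vectorspace) functional_lincomb:
  assumes "finite A" "A \<subseteq> carrier V" "a \<in> A \<rightarrow> carrier K"
    and g: "g \<in> carrier V \<rightarrow> carrier K"
    and add: "\<And>v w. v \<in> carrier V \<Longrightarrow> w \<in> carrier V \<Longrightarrow> g (v \<oplus>\<^bsub>V\<^esub> w) = g v \<oplus>\<^bsub>K\<^esub> g w"
    and smult: "\<And>c v. c \<in> carrier K \<Longrightarrow> v \<in> carrier V \<Longrightarrow> g (c \<odot>\<^bsub>V\<^esub> v) = c \<otimes>\<^bsub>K\<^esub> g v"
  shows "g (lincomb a A) = (\<Oplus>\<^bsub>K\<^esub>v\<in>A. a v \<otimes>\<^bsub>K\<^esub> g v)"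
  using assms(1-3)
proof (induction A rule: finite_induct)
  case empty
  have "g (\<zero>\<^bsub>K\<^esub> \<odot>\<^bsub>V\<^esub> \<zero>\<^bsub>V\<^esub>) = \<zero>\<^bsub>K\<^esub> \<otimes>\<^bsub>K\<^esub> g \<zero>\<^bsub>V\<^esub>" by (rule smult) auto
  moreover have "g \<zero>\<^bsub>V\<^esub> \<in> carrier K" using g by auto
  ultimately have "g \<zero>\<^bsub>V\<^esub> = \<zero>\<^bsub>K\<^esub>" by simp
  then show ?case by (simp add: lincomb_def)
next
  case (insert v A)
  have a: "a v \<in> carrier K" "a \<in> A \<rightarrow> carrier K" and v: "v \<in> carrier V" "A \<subseteq> carrier V"
    using insert.prems by auto
  have "lincomb a (insert v A) = a v \<odot>\<^bsub>V\<^esub> v \<oplus>\<^bsub>V\<^esub> lincomb a A"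
    using insert a v unfolding lincomb_def by (subst finsum_insert) auto
  moreover have "(\<Oplus>\<^bsub>K\<^esub>w\<in>insert v A. a w \<otimes>\<^bsub>K\<^esub> g w) = a v \<otimes>\<^bsub>K\<^esub> g v \<oplus>\<^bsub>K\<^esub> (\<Oplus>\<^bsub>K\<^esub>w\<in>A. a w \<otimes>\<^bsub>K\<^esub> g w)"
    using insert a v g by (subst R.finsum_insert) auto
  ultimately show ?case using insert a v by (simp add: add smult)
qed

text \<open>Each \<open>g i\<close> reads off the coefficient of \<open>b i\<close>, which gives
  independence. Subtracting from \<open>v\<close> the combination with coefficients
  \<open>g i v\<close> leaves a vector killed by all functionals, hence zero, which gives
  spanning.\<close>

lemma (in vectorspace) dual_family_basis:
  fixes I :: "'i set" and g :: "'i \<Rightarrow> 'c \<Rightarrow> 'a"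
  assumes fin: "finite I" and b: "b \<in> I \<rightarrow> carrier V"
    and g: "\<And>i. i \<in> I \<Longrightarrow> g i \<in> carrier V \<rightarrow> carrier K"
    and add: "\<And>i v w. i \<in> I \<Longrightarrow> v \<in> carrier V \<Longrightarrow> w \<in> carrier V \<Longrightarrow> g i (v \<oplus>\<^bsub>V\<^esub> w) = g i v \<oplus>\<^bsub>K\<^esub> g i w"
    and smult: "\<And>i c v. i \<in> I \<Longrightarrow> c \<in> carrier K \<Longrightarrow> v \<in> carrier V \<Longrightarrow> g i (c \<odot>\<^bsub>V\<^esub> v) = c \<otimes>\<^bsub>K\<^esub> g i v"
    and dual: "\<And>i j. i \<in> I \<Longrightarrow> j \<in> I \<Longrightarrow> g i (b j) = (if i = j then \<one>\<^bsub>K\<^esub> else \<zero>\<^bsub>K\<^esub>)"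
    and sep: "\<And>v. v \<in> carrier V \<Longrightarrow> (\<And>i. i \<in> I \<Longrightarrow> g i v = \<zero>\<^bsub>K\<^esub>) \<Longrightarrow> v = \<zero>\<^bsub>V\<^esub>"
  shows "basis (b ` I)" "dim = card I"
proof -
  have inj: "inj_on b I"
  proof (rule inj_onI)
    fix i j assume "i \<in> I" "j \<in> I" "b i = b j"
    then show "i = j" using dual[of i i] dual[of i j] by (auto split: if_splits)
  qed
  have B: "finite (b ` I)" "b ` I \<subseteq> carrier V" using fin b by auto
  have coord: "g i (lincomb a (b ` I)) = a (b i)" if "i \<in> I" "a \<in> b ` I \<rightarrow> carrier K" for i a
  proof -
    have "g i (lincomb a (b ` I)) = (\<Oplus>\<^bsub>K\<^esub>v\<in>b ` I. a v \<otimes>\<^bsub>K\<^esub> g i v)"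
      using that B g add smult by (intro functional_lincomb) auto
    also have "\<dots> = (\<Oplus>\<^bsub>K\<^esub>j\<in>I. a (b j) \<otimes>\<^bsub>K\<^esub> g i (b j))"
      using inj that funcset_mem[OF g[OF that(1)]] b by (intro R.finsum_reindex) (auto simp: Pi_iff)
    also have "\<dots> = (\<Oplus>\<^bsub>K\<^esub>j\<in>I. if i = j then a (b j) else \<zero>\<^bsub>K\<^esub>)"
      using that by (intro R.finsum_cong') (auto simp: dual Pi_iff)
    also have "\<dots> = a (b i)"
      using that fin by (intro R.finsum_singleton) auto
    finally show ?thesis .
  qed
  have "lin_indpt (b ` I)"
  proof (rule finite_lin_indpt2[OF B], intro ballI)
    fix a v assume a: "a \<in> b ` I \<rightarrow> carrier K" "lincomb a (b ` I) = \<zero>\<^bsub>V\<^esub>" and "v \<in> b ` I"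
    then obtain i where i: "i \<in> I" "v = b i" by auto
    have "g i (\<zero>\<^bsub>K\<^esub> \<odot>\<^bsub>V\<^esub> \<zero>\<^bsub>V\<^esub>) = \<zero>\<^bsub>K\<^esub> \<otimes>\<^bsub>K\<^esub> g i \<zero>\<^bsub>V\<^esub>" using i by (intro smult) auto
    moreover have "g i \<zero>\<^bsub>V\<^esub> \<in> carrier K" using g i by auto
    ultimately have "g i \<zero>\<^bsub>V\<^esub> = \<zero>\<^bsub>K\<^esub>" by simp
    then show "a v = \<zero>\<^bsub>K\<^esub>" using coord[OF i(1) a(1)] a(2) i(2) by simp
  qed
  moreover have "gen_set (b ` I)"
  proof
    show "span (b ` I) \<subseteq> carrier V" using B by (simp add: span_is_subset2)
    show "carrier V \<subseteq> span (b ` I)"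
    proof
      fix v assume v: "v \<in> carrier V"
      \<comment> \<open>\<open>lincomb\<close> indexes coefficients by vectors, so the index is
        recovered through the inverse of \<open>b\<close>, which duality has made injective on
        \<open>I\<close>.\<close>
      define a where "a w = g (the_inv_into I b w) v" for w
      have a: "a \<in> b ` I \<rightarrow> carrier K" "\<And>i. i \<in> I \<Longrightarrow> a (b i) = g i v"
        using funcset_mem[OF g v] inj by (auto simp: a_def the_inv_into_f_f)
      define w where "w = lincomb a (b ` I)"
      have w: "w \<in> carrier V" unfolding w_def using a B by auto
      have "v \<ominus>\<^bsub>V\<^esub> w = \<zero>\<^bsub>V\<^esub>"
      proof (rule sep)
        show "v \<ominus>\<^bsub>V\<^esub> w \<in> carrier V" using v w by simp
        fix i assume i: "i \<in> I"
        have "g i w = g i v" using coord[OF i a(1)] a(2)[OF i] by (simp add: w_def)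
        have gv: "g i v \<in> carrier K" using g i v by auto
        have "v \<ominus>\<^bsub>V\<^esub> w = v \<oplus>\<^bsub>V\<^esub> (\<ominus>\<^bsub>K\<^esub> \<one>\<^bsub>K\<^esub>) \<odot>\<^bsub>V\<^esub> w"
          using v w by (simp add: smult_minus_1 M.minus_eq)
        then have "g i (v \<ominus>\<^bsub>V\<^esub> w) = g i v \<oplus>\<^bsub>K\<^esub> (\<ominus>\<^bsub>K\<^esub> \<one>\<^bsub>K\<^esub>) \<otimes>\<^bsub>K\<^esub> g i w"
          using v w i by (simp add: add smult)
        then show "g i (v \<ominus>\<^bsub>V\<^esub> w) = \<zero>\<^bsub>K\<^esub>"
          using gv \<open>g i w = g i v\<close> by (simp add: R.l_minus R.r_neg)
      qed
      then have "v = w" using v w by (metis M.minus_eq M.minus_equality M.minus_minus M.a_inv_closed)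
      then show "v \<in> span (b ` I)" using a B by (auto simp: finite_span w_def)
    qed
  qed
  ultimately show "basis (b ` I)" unfolding basis_def using B by simp
  then show "dim = card I" using dim_basis[OF B(1)] card_image[OF inj] by simp
qed

text \<open>Negation is scaling by -1. The result opens the coset calculus of abelian subgroups to
  submodules.\<close>

lemma (in submodule) is_abelian_subgroup:
  "abelian_subgroup N M"
proof -
  have "N \<noteq> {}" using zero_closed by blast
  interpret Module.module R M by (rule module)
  have "subgroup N (add_monoid M)"
  proof (rule M.add.subgroupI)
    fix v assume "v \<in> N"
    then have "(\<ominus>\<^bsub>R\<^esub> \<one>\<^bsub>R\<^esub>) \<odot> v \<in> N" by auto
    then show "\<ominus> v \<in> N" using \<open>v \<in> N\<close> subset smult_minus_1[of v] by (metis subsetD)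
  qed (use subset \<open>N \<noteq> {}\<close> in auto)
  then show ?thesis
    by (intro abelian_subgroupI3 additive_subgroupI) (auto simp: M.abelian_group_axioms)
qed

lemma quotient_vectorspace:
  fixes M :: "('k, 'v) module"
  assumes "vectorspace K M" and sub: "submodule K N M"
  shows "vectorspace K (quotient_module M N)"
    and "carrier (quotient_module M N) = (\<lambda>v. N +>\<^bsub>M\<^esub> v) ` carrier M"
    and "\<And>v w. v \<in> carrier M \<Longrightarrow> w \<in> carrier M \<Longrightarrow>
      (N +>\<^bsub>M\<^esub> v) \<oplus>\<^bsub>quotient_module M N\<^esub> (N +>\<^bsub>M\<^esub> w) = N +>\<^bsub>M\<^esub> (v \<oplus>\<^bsub>M\<^esub> w)"
    and "\<And>c v. c \<in> carrier K \<Longrightarrow> v \<in> carrier M \<Longrightarrow>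
      c \<odot>\<^bsub>quotient_module M N\<^esub> (N +>\<^bsub>M\<^esub> v) = N +>\<^bsub>M\<^esub> (c \<odot>\<^bsub>M\<^esub> v)"
    and "\<And>v w. v \<in> carrier M \<Longrightarrow> w \<in> carrier M \<Longrightarrow>
      N +>\<^bsub>M\<^esub> v = N +>\<^bsub>M\<^esub> w \<Longrightarrow> \<exists>n\<in>N. v = n \<oplus>\<^bsub>M\<^esub> w"
    and "\<And>v. v \<in> N \<Longrightarrow> N +>\<^bsub>M\<^esub> v = \<zero>\<^bsub>quotient_module M N\<^esub>"
proof -
  interpret vectorspace K M by fact
  interpret S: submodule K N M by fact
  interpret N: abelian_subgroup N M by (rule S.is_abelian_subgroup)
  let ?Q = "quotient_module M N"
  show car: "carrier ?Q = (\<lambda>v. N +>\<^bsub>M\<^esub> v) ` carrier M"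
    by (auto simp: quotient_module_def A_RCOSETS_def')
  show add: "(N +>\<^bsub>M\<^esub> v) \<oplus>\<^bsub>?Q\<^esub> (N +>\<^bsub>M\<^esub> w) = N +>\<^bsub>M\<^esub> (v \<oplus>\<^bsub>M\<^esub> w)"
    if "v \<in> carrier M" "w \<in> carrier M" for v w
    using that by (simp add: quotient_module_def N.a_rcos_sum)
  show smult: "c \<odot>\<^bsub>?Q\<^esub> (N +>\<^bsub>M\<^esub> v) = N +>\<^bsub>M\<^esub> (c \<odot>\<^bsub>M\<^esub> v)"
    if c: "c \<in> carrier K" and v: "v \<in> carrier M" for c v
  proof -
    \<comment> \<open>All members of a coset scale into one and the same coset, so the union that
      defines scalar multiplication collapses to a single term.\<close>
    have "N +>\<^bsub>M\<^esub> (c \<odot>\<^bsub>M\<^esub> w) = N +>\<^bsub>M\<^esub> (c \<odot>\<^bsub>M\<^esub> v)" if w: "w \<in> N +>\<^bsub>M\<^esub> v" for w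
    proof -
      obtain n where n: "n \<in> N" "w = n \<oplus>\<^bsub>M\<^esub> v" using w by (auto simp: a_r_coset_def')
      have "c \<odot>\<^bsub>M\<^esub> w = c \<odot>\<^bsub>M\<^esub> n \<oplus>\<^bsub>M\<^esub> c \<odot>\<^bsub>M\<^esub> v"
        using n c v by (simp add: smult_r_distr)
      moreover have "c \<odot>\<^bsub>M\<^esub> n \<in> N" using n c by auto
      ultimately have "c \<odot>\<^bsub>M\<^esub> w \<in> N +>\<^bsub>M\<^esub> (c \<odot>\<^bsub>M\<^esub> v)" by (auto simp: a_r_coset_def')
      then show ?thesis using N.a_repr_independence' c v by auto
    qed
    then have "(\<Union>w\<in>N +>\<^bsub>M\<^esub> v. N +>\<^bsub>M\<^esub> (c \<odot>\<^bsub>M\<^esub> w)) = N +>\<^bsub>M\<^esub> (c \<odot>\<^bsub>M\<^esub> v)"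
      using N.a_rcos_self[OF v] by blast
    then show ?thesis by (simp add: quotient_module_def)
  qed
  show "\<exists>n\<in>N. v = n \<oplus>\<^bsub>M\<^esub> w"
    if "v \<in> carrier M" "w \<in> carrier M" "N +>\<^bsub>M\<^esub> v = N +>\<^bsub>M\<^esub> w" for v w
    using N.a_rcos_self[OF that(1)] that(3) by (auto simp: a_r_coset_def')
  show zero: "N +>\<^bsub>M\<^esub> v = \<zero>\<^bsub>?Q\<^esub>" if "v \<in> N" for v
    using that by (simp add: quotient_module_def N.a_rcos_const)
  \<comment> \<open>With zero also written as the coset of a representative, every module axiom
    below is the corresponding axiom of \<open>M\<close> applied to representatives.\<close>
  then have zero0: "\<zero>\<^bsub>?Q\<^esub> = N +>\<^bsub>M\<^esub> \<zero>\<^bsub>M\<^esub>" by simp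
  have "Module.module K ?Q"
  proof (rule module_criteria, unfold car, goal_cases)
    case 1 show ?case by (rule R.is_cring)
  next
    case 2 show ?case unfolding zero0 by (intro imageI) simp
  next
    case 3 show ?case by (clarify, subst add) (auto intro: imageI)
  next
    case 4 show ?case
    proof clarify
      fix v assume "v \<in> carrier M"
      then show "\<exists>D\<in>(\<lambda>v. N +>\<^bsub>M\<^esub> v) ` carrier M. (N +>\<^bsub>M\<^esub> v) \<oplus>\<^bsub>?Q\<^esub> D = \<zero>\<^bsub>?Q\<^esub>"
        by (intro bexI[of _ "N +>\<^bsub>M\<^esub> (\<ominus>\<^bsub>M\<^esub> v)"]) (simp_all add: add M.r_neg zero)
    qed
  next
    case 5 show ?case by (clarify, subst smult) (auto intro: imageI)
  next
    case 6 show ?case by (clarify, simp only: add M.a_comm)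
  next
    case 7 show ?case by (clarify, simp only: add M.add.m_closed M.a_assoc)
  next
    case 8 show ?case by (clarify, simp only: zero0 add M.zero_closed M.r_zero)
  next
    case 9 show ?case by (clarify, simp only: smult smult_closed smult_assoc1 R.m_closed)
  next
    case 10 show ?case by (clarify, simp only: smult R.one_closed smult_one)
  next
    case 11 show ?case by (clarify, simp only: add smult smult_closed smult_l_distr R.add.m_closed)
  next
    case 12 show ?case by (clarify, simp only: add smult smult_closed smult_r_distr M.add.m_closed)
  qed
  then show "vectorspace K ?Q" by (intro vectorspace.intro field_axioms)
qed

text \<open>Functionals vanishing on \<open>N\<close> descend to the quotient, and they separate its
  points because \<open>N\<close> is all of their common kernel. This reduces the situation to a
  dual family in the quotient.\<close>

lemma quotient_dual_family_basis:
  fixes M :: "('k, 'v) module" and I :: "'i set"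
  assumes vs: "vectorspace K M" and N: "N = {v \<in> carrier M. \<forall>i\<in>I. g i v = \<zero>\<^bsub>K\<^esub>}"
    and finI: "finite I" and b: "b \<in> I \<rightarrow> carrier M"
    and g: "\<And>i. i \<in> I \<Longrightarrow> g i \<in> carrier M \<rightarrow> carrier K"
    and add: "\<And>i v w. i \<in> I \<Longrightarrow> v \<in> carrier M \<Longrightarrow> w \<in> carrier M \<Longrightarrow> g i (v \<oplus>\<^bsub>M\<^esub> w) = g i v \<oplus>\<^bsub>K\<^esub> g i w"
    and smult: "\<And>i c v. i \<in> I \<Longrightarrow> c \<in> carrier K \<Longrightarrow> v \<in> carrier M \<Longrightarrow> g i (c \<odot>\<^bsub>M\<^esub> v) = c \<otimes>\<^bsub>K\<^esub> g i v"
    and dual: "\<And>i j. i \<in> I \<Longrightarrow> j \<in> I \<Longrightarrow> g i (b j) = (if i = j then \<one>\<^bsub>K\<^esub> else \<zero>\<^bsub>K\<^esub>)"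
  shows "vectorspace K (quotient_module M N)"
    and "vectorspace.basis K (quotient_module M N) ((\<lambda>i. N +>\<^bsub>M\<^esub> b i) ` I)"
    and "vectorspace.dim K (quotient_module M N) = card I"
proof -
  interpret vectorspace K M by fact
  have g0: "g i \<zero>\<^bsub>M\<^esub> = \<zero>\<^bsub>K\<^esub>" if "i \<in> I" for i
    using smult[OF that R.zero_closed M.zero_closed] funcset_mem[OF g[OF that] M.zero_closed] by simp
  have sub: "submodule K N M"
    by (rule submodule.intro[OF module_axioms])
       (auto simp: N add smult g0)
  note Q = quotient_vectorspace[OF vs sub]
  let ?Q = "quotient_module M N"
  show vsQ: "vectorspace K ?Q" by (rule Q)
  \<comment> \<open>The descended functional evaluates at a chosen representative; by additivity and
    vanishing on \<open>N\<close> the choice is immaterial.\<close>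
  define G where "G i C = g i (SOME v. v \<in> carrier M \<and> C = N +>\<^bsub>M\<^esub> v)" for i C
  have G: "G i (N +>\<^bsub>M\<^esub> v) = g i v" if i: "i \<in> I" and v: "v \<in> carrier M" for i v
  proof -
    define w where "w = (SOME w. w \<in> carrier M \<and> N +>\<^bsub>M\<^esub> v = N +>\<^bsub>M\<^esub> w)"
    have w: "w \<in> carrier M \<and> N +>\<^bsub>M\<^esub> v = N +>\<^bsub>M\<^esub> w"
      unfolding w_def by (rule someI) (use v in simp)
    then obtain n where n: "n \<in> N" "v = n \<oplus>\<^bsub>M\<^esub> w" using Q(5)[OF v, of w] by auto
    have "n \<in> carrier M" "g i n = \<zero>\<^bsub>K\<^esub>" using n(1) i by (auto simp: N)
    then have "g i v = g i w"
      using add[OF i, of n w] funcset_mem[OF g[OF i], of w] w by (simp add: n(2))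
    then show ?thesis by (simp add: G_def w_def)
  qed
  let ?b = "\<lambda>i. N +>\<^bsub>M\<^esub> b i"
  have sep: "C = \<zero>\<^bsub>?Q\<^esub>" if C: "C \<in> carrier ?Q" "\<And>i. i \<in> I \<Longrightarrow> G i C = \<zero>\<^bsub>K\<^esub>" for C
  proof -
    obtain v where v: "v \<in> carrier M" "C = N +>\<^bsub>M\<^esub> v" using C(1) by (auto simp: Q(2))
    have "\<forall>i\<in>I. g i v = \<zero>\<^bsub>K\<^esub>" using C(2) G[OF _ v(1)] v(2) by simp
    then have "v \<in> N" using v(1) N by blast
    then show ?thesis by (simp only: v(2) Q(6))
  qed
  have family: "?b \<in> I \<rightarrow> carrier ?Q" "\<And>i. i \<in> I \<Longrightarrow> G i \<in> carrier ?Q \<rightarrow> carrier K"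
    "\<And>i C D. i \<in> I \<Longrightarrow> C \<in> carrier ?Q \<Longrightarrow> D \<in> carrier ?Q \<Longrightarrow> G i (C \<oplus>\<^bsub>?Q\<^esub> D) = G i C \<oplus>\<^bsub>K\<^esub> G i D"
    "\<And>i c C. i \<in> I \<Longrightarrow> c \<in> carrier K \<Longrightarrow> C \<in> carrier ?Q \<Longrightarrow> G i (c \<odot>\<^bsub>?Q\<^esub> C) = c \<otimes>\<^bsub>K\<^esub> G i C"
    "\<And>i j. i \<in> I \<Longrightarrow> j \<in> I \<Longrightarrow> G i (?b j) = (if i = j then \<one>\<^bsub>K\<^esub> else \<zero>\<^bsub>K\<^esub>)"
    using b g by (auto simp: Q(2,3,4) G add smult dual Pi_iff)
  show "vectorspace.basis K ?Q (?b ` I)" "vectorspace.dim K ?Q = card I"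
    by (rule vectorspace.dual_family_basis[OF vsQ finI family sep]; assumption)+
qed


subsection \<open>Multilinear forms on the superalgebra\<close>

lemma finite_gens [simp]: "finite (gens p)"
  by (simp add: gens_def)

lemma X_in_gens [simp]: "X i \<in> gens p \<longleftrightarrow> 1 \<le> i \<and> i \<le> p"
  by (auto simp: gens_def)

lemma Y_in_gens [simp]: "Y i \<in> gens p \<longleftrightarrow> 1 \<le> i \<and> i \<le> p"
  by (auto simp: gens_def)

lemma bas_Lpp [simp]: "(bas a :: 'a::field elt) \<in> Lpp p \<longleftrightarrow> a \<in> gens p"
proof -
  have "(\<forall>g. g \<notin> gens p \<longrightarrow> (bas a g :: 'a) = 0) \<longleftrightarrow> a \<in> gens p"
    by (auto simp: bas_def)
  then show ?thesis by (simp add: Lpp_def)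
qed

lemma bas_hom_space: "a \<in> gens p \<Longrightarrow> (bas a :: 'a::field elt) \<in> hom_space p (parity a)"
  by (auto simp: hom_space_def) (auto simp: bas_def)

lemma hom_space_Lpp: "x \<in> hom_space p e \<Longrightarrow> x \<in> Lpp p"
  by (simp add: hom_space_def)

lemma Lpp_zero [simp]: "(\<lambda>g. 0) \<in> Lpp p"
  by (simp add: Lpp_def)

lemma Lpp_lincomb:
  "x \<in> Lpp p \<Longrightarrow> y \<in> Lpp p \<Longrightarrow> (\<lambda>g. c * x g + d * y g) \<in> Lpp p" for c :: "'a::field"
  by (simp add: Lpp_def)

lemma Lpp_add: "x \<in> Lpp p \<Longrightarrow> y \<in> Lpp p \<Longrightarrow> (\<lambda>g. x g + y g) \<in> Lpp p" for x y :: "'a::field elt"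
  by (simp add: Lpp_def)

lemma Lpp_smult: "x \<in> Lpp p \<Longrightarrow> (\<lambda>g. c * x g) \<in> Lpp p" for c :: "'a::field"
  by (simp add: Lpp_def)

lemma hom_part_Lpp: "x \<in> Lpp p \<Longrightarrow> hom_part e x \<in> hom_space p e"
  by (auto simp: hom_space_def hom_part_def Lpp_def)

lemma parity_cases: "parity g = 0 \<or> parity g = 1"
  by (cases g) auto

lemma hom_part_sum: "(\<lambda>g. hom_part 0 x g + hom_part 1 x g) = x" for x :: "'a::field elt"
  by (rule ext, case_tac g) (simp_all add: hom_part_def)

lemma C1_add: "f \<in> C1 p \<Longrightarrow> x \<in> Lpp p \<Longrightarrow> y \<in> Lpp p \<Longrightarrow> f (\<lambda>g. x g + y g) = f x + f y"
  by (simp add: C1_def)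

lemma C1_smult: "f \<in> C1 p \<Longrightarrow> x \<in> Lpp p \<Longrightarrow> f (\<lambda>g. c * x g) = c * f x"
  by (simp add: C1_def)

lemma C1_outside: "f \<in> C1 p \<Longrightarrow> x \<notin> Lpp p \<Longrightarrow> f x = 0"
  by (simp add: C1_def)

lemma C1_zero: "f \<in> C1 p \<Longrightarrow> f (\<lambda>g. 0) = 0"
  using C1_smult[of f p "\<lambda>g. 0" 0] by simp

lemma C1_lincomb:
  assumes "f \<in> C1 p" "x \<in> Lpp p" "y \<in> Lpp p"
  shows "f (\<lambda>g. c * x g + d * y g) = c * f x + d * f y"
  using C1_add[OF assms(1) Lpp_smult[OF assms(2)] Lpp_smult[OF assms(3)]]
  by (simp add: C1_smult[OF assms(1)] assms)

lemma C1_expand: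
  assumes f: "f \<in> C1 p" and x: "x \<in> Lpp p"
  shows "f x = (\<Sum>a\<in>gens p. x a * f (bas a))"
proof -
  have "finite A \<Longrightarrow> A \<subseteq> gens p \<Longrightarrow>
      (\<lambda>g. if g \<in> A then x g else 0) \<in> Lpp p \<and> f (\<lambda>g. if g \<in> A then x g else 0) = (\<Sum>a\<in>A. x a * f (bas a))" for A
  proof (induction A rule: finite_induct)
    case empty
    then show ?case using C1_zero[OF f] by simp
  next
    case (insert a A)
    have eq: "(\<lambda>g. if g \<in> insert a A then x g else 0) = (\<lambda>g. x a * bas a g + 1 * (if g \<in> A then x g else 0))"
      using insert.hyps by (auto simp: bas_def)
    show ?case unfolding eq
      using insert Lpp_lincomb[of "bas a" p "\<lambda>g. if g \<in> A then x g else 0" "x a" 1]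
        C1_lincomb[OF f, of "bas a" "\<lambda>g. if g \<in> A then x g else 0" "x a" 1] by simp
  qed
  from this[of "gens p"] have "f (\<lambda>g. if g \<in> gens p then x g else 0) = (\<Sum>a\<in>gens p. x a * f (bas a))"
    by simp
  moreover have "(\<lambda>g. if g \<in> gens p then x g else 0) = x"
    using x by (auto simp: Lpp_def)
  ultimately show ?thesis by simp
qed

lemma C1_I:
  fixes c :: "gen \<Rightarrow> 'a::field"
  shows "(\<lambda>x. if x \<in> Lpp p then \<Sum>a\<in>gens p. x a * c a else 0) \<in> C1 p"
  by (auto simp: C1_def Lpp_add Lpp_smult sum.distrib sum_distrib_left algebra_simps)

lemma C2_left: "\<alpha> \<in> C2 p \<Longrightarrow> \<alpha> x \<in> C1 p"
  by (simp add: C2_def)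

lemma C2_right: "\<alpha> \<in> C2 p \<Longrightarrow> (\<lambda>x. \<alpha> x y) \<in> C1 p"
  by (simp add: C2_def)

lemma C2_skew:
  "\<alpha> \<in> C2 p \<Longrightarrow> a \<in> {0, 1} \<Longrightarrow> b \<in> {0, 1} \<Longrightarrow> x \<in> hom_space p a \<Longrightarrow> y \<in> hom_space p b \<Longrightarrow>
    \<alpha> x y = - ((-1) ^ (a * b) * \<alpha> y x)"
  unfolding C2_def by blast

lemma C2_bas_skew:
  assumes "\<alpha> \<in> C2 p" "a \<in> gens p" "b \<in> gens p"
  shows "\<alpha> (bas a) (bas b) = - ((-1) ^ (parity a * parity b) * \<alpha> (bas b) (bas a))"
  using assms parity_cases by (intro C2_skew) (auto intro: bas_hom_space)

lemma C2_outside: "\<alpha> \<in> C2 p \<Longrightarrow> x \<notin> Lpp p \<or> y \<notin> Lpp p \<Longrightarrow> \<alpha> x y = 0"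
  using C1_outside[OF C2_left] C1_outside[OF C2_right] by blast

lemma C2_zero:
  assumes "\<alpha> \<in> C2 p"
  shows "\<alpha> (\<lambda>g. 0) y = 0" "\<alpha> x (\<lambda>g. 0) = 0"
  using C1_zero[OF C2_left] C1_zero[OF C2_right] assms by auto

lemma C2_expand:
  assumes \<alpha>: "\<alpha> \<in> C2 p" and x: "x \<in> Lpp p" and y: "y \<in> Lpp p"
  shows "\<alpha> x y = (\<Sum>a\<in>gens p. \<Sum>b\<in>gens p. x a * y b * \<alpha> (bas a) (bas b))"
proof -
  have "\<alpha> x y = (\<Sum>a\<in>gens p. x a * \<alpha> (bas a) y)"
    using C1_expand[OF C2_right[OF \<alpha>] x] .
  also have "\<dots> = (\<Sum>a\<in>gens p. x a * (\<Sum>b\<in>gens p. y b * \<alpha> (bas a) (bas b)))"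
    using C1_expand[OF C2_left[OF \<alpha>] y] by simp
  finally show ?thesis by (simp add: sum_distrib_left mult.assoc)
qed

lemma C2_eqI:
  assumes "\<alpha> \<in> C2 p" "\<beta> \<in> C2 p"
    and "\<And>a b. a \<in> gens p \<Longrightarrow> b \<in> gens p \<Longrightarrow> \<alpha> (bas a) (bas b) = \<beta> (bas a) (bas b)"
  shows "\<alpha> = \<beta>"
proof (intro ext)
  fix x y
  show "\<alpha> x y = \<beta> x y"
  proof (cases "x \<in> Lpp p \<and> y \<in> Lpp p")
    case True
    then show ?thesis
      using C2_expand[OF assms(1), of x y] C2_expand[OF assms(2), of x y] by (simp add: assms(3))
  next
    case False
    then show ?thesis using assms C2_outside by metis
  qed
qed

lemma C2_lincomb:
  assumes "\<alpha> \<in> C2 p" "\<beta> \<in> C2 p"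
  shows "(\<lambda>x y. c * \<alpha> x y + d * \<beta> x y) \<in> C2 p"
proof -
  have C1: "(\<lambda>x. c * f x + d * h x) \<in> C1 p" if "f \<in> C1 p" "h \<in> C1 p" for f h
    using that by (simp add: C1_def algebra_simps)
  show ?thesis
    unfolding C2_def
  proof (intro CollectI conjI allI ballI)
    show "(\<lambda>y. c * \<alpha> x y + d * \<beta> x y) \<in> C1 p" for x using assms C2_left by (intro C1) auto
    show "(\<lambda>x. c * \<alpha> x y + d * \<beta> x y) \<in> C1 p" for y using assms C2_right by (intro C1) auto
    fix a b :: nat and x y :: "'a elt"
    assume "a \<in> {0, 1}" "b \<in> {0, 1}" "x \<in> hom_space p a" "y \<in> hom_space p b"
    then have "\<alpha> x y = - ((-1) ^ (a * b) * \<alpha> y x)" "\<beta> x y = - ((-1) ^ (a * b) * \<beta> y x)"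
      using assms C2_skew by blast+
    then show "c * \<alpha> x y + d * \<beta> x y = - ((- 1) ^ (a * b) * (c * \<alpha> y x + d * \<beta> y x))"
      by (simp add: algebra_simps)
  qed
qed

lemma C2_zero_form: "(\<lambda>x y. 0) \<in> C2 p"
  by (simp add: C2_def C1_def)

lemma C2_sum:
  assumes "finite A" "\<And>i. i \<in> A \<Longrightarrow> \<alpha> i \<in> C2 p"
  shows "(\<lambda>x y. \<Sum>i\<in>A. c i * \<alpha> i x y) \<in> C2 p"
  using assms
proof (induction A rule: finite_induct)
  case empty
  then show ?case by (simp add: C2_zero_form)
next
  case (insert i A)
  then show ?case using C2_lincomb[of "\<alpha> i" p "\<lambda>x y. \<Sum>i\<in>A. c i * \<alpha> i x y" "c i" 1] by simp
qed

lemma sum_gens_bas: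
  assumes "a \<in> gens p"
  shows "(\<Sum>b\<in>gens p. bas a b * f b) = (f a :: 'a::field)"
  using assms by (simp add: bas_def if_distrib[of "\<lambda>x. x * _"] cong: if_cong)

lemma bilinear_ext_bas:
  assumes "a \<in> gens p" "b \<in> gens p"
  shows "bilinear_ext p c (bas a) (bas b) = (c a b :: 'a::field)"
proof -
  have "bilinear_ext p c (bas a) (bas b) = (\<Sum>a'\<in>gens p. bas a a' * (\<Sum>b'\<in>gens p. bas b b' * c a' b'))"
    using assms by (simp add: bilinear_ext_def sum_distrib_left mult.assoc)
  then show ?thesis using assms by (simp add: sum_gens_bas)
qed

text \<open>A homogeneous element has zero coordinates at generators of the other parity, so only
  those pairs of generators contribute whose sign agrees with the sign demanded of the
  arguments.\<close>

lemma bilinear_ext_C2: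
  fixes c :: "gen \<Rightarrow> gen \<Rightarrow> 'a::field"
  assumes skew: "\<And>a b. a \<in> gens p \<Longrightarrow> b \<in> gens p \<Longrightarrow> c a b = - ((-1) ^ (parity a * parity b) * c b a)"
  shows "bilinear_ext p c \<in> C2 p"
  unfolding C2_def
proof (intro CollectI conjI allI ballI)
  fix x :: "'a elt"
  have "bilinear_ext p c x = (\<lambda>y. if y \<in> Lpp p then \<Sum>b\<in>gens p. y b * (if x \<in> Lpp p then \<Sum>a\<in>gens p. x a * c a b else 0) else 0)"
    by (rule ext, simp add: bilinear_ext_def sum_distrib_left, subst sum.swap, simp add: algebra_simps)
  then show "bilinear_ext p c x \<in> C1 p" by (simp only: C1_I)
next
  fix y :: "'a elt"
  have "(\<lambda>x. bilinear_ext p c x y) = (\<lambda>x. if x \<in> Lpp p then \<Sum>a\<in>gens p. x a * (if y \<in> Lpp p then \<Sum>b\<in>gens p. y b * c a b else 0) else 0)"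
    by (rule ext, simp add: bilinear_ext_def sum_distrib_left mult.assoc)
  then show "(\<lambda>x. bilinear_ext p c x y) \<in> C1 p" by (simp only: C1_I)
next
  fix i j :: nat and x y :: "'a elt"
  assume x: "x \<in> hom_space p i" and y: "y \<in> hom_space p j"
  have "bilinear_ext p c x y = (\<Sum>a\<in>gens p. \<Sum>b\<in>gens p. x a * y b * c a b)"
    using x y by (simp add: bilinear_ext_def hom_space_Lpp)
  also have "\<dots> = (\<Sum>a\<in>gens p. \<Sum>b\<in>gens p. - ((-1) ^ (i * j) * (y b * x a * c b a)))"
  proof (intro sum.cong refl)
    fix a b assume ab: "a \<in> gens p" "b \<in> gens p"
    show "x a * y b * c a b = - ((-1) ^ (i * j) * (y b * x a * c b a))"
    proof (cases "parity a = i \<and> parity b = j")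
      case True
      then show ?thesis using skew[OF ab] by (simp add: algebra_simps)
    next
      case False
      then have "x a = 0 \<or> y b = 0" using x y by (auto simp: hom_space_def)
      then show ?thesis by auto
    qed
  qed
  also have "\<dots> = (\<Sum>b\<in>gens p. \<Sum>a\<in>gens p. - ((-1) ^ (i * j) * (y b * x a * c b a)))"
    by (rule sum.swap)
  also have "\<dots> = - ((-1) ^ (i * j) * bilinear_ext p c y x)"
    using x y by (simp add: bilinear_ext_def hom_space_Lpp sum_negf sum_distrib_left)
  finally show "bilinear_ext p c x y = - ((-1) ^ (i * j) * bilinear_ext p c y x)" .
qed


subsection \<open>The bracket through the derivation \<open>ad X\<^sub>1\<close>\<close>

text \<open>The derivation is a shift of coordinates. The X-shift starts at 3 because X_1 commutes
  with itself: nothing maps to X_2, whereas Y_1 does map to Y_2.\<close>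

definition adX1 :: "nat \<Rightarrow> 'a::field elt \<Rightarrow> 'a elt" where
  "adX1 p x = (\<lambda>g. case g of
     X i \<Rightarrow> if 3 \<le> i \<and> i \<le> p then x (X (i - 1)) else 0
   | Y j \<Rightarrow> if 2 \<le> j \<and> j \<le> p then x (Y (j - 1)) else 0)"

lemma adX1_simps [simp]:
  "adX1 p x (X i) = (if 3 \<le> i \<and> i \<le> p then x (X (i - 1)) else 0)"
  "adX1 p x (Y j) = (if 2 \<le> j \<and> j \<le> p then x (Y (j - 1)) else 0)"
  by (simp_all add: adX1_def)

lemma adX1_bas [simp]:
  "adX1 p (bas (X i)) = (if 2 \<le> i \<and> i < p then bas (X (i + 1)) else (\<lambda>g. 0 :: 'a::field))"
  "adX1 p (bas (Y j)) = (if 1 \<le> j \<and> j < p then bas (Y (j + 1)) else (\<lambda>g. 0 :: 'a::field))"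
proof -
  have "adX1 p (bas (X i)) g = (if 2 \<le> i \<and> i < p then bas (X (i + 1)) else (\<lambda>g. 0 :: 'a)) g"
    "adX1 p (bas (Y j)) g = (if 1 \<le> j \<and> j < p then bas (Y (j + 1)) else (\<lambda>g. 0 :: 'a)) g" for g
    by (cases g; auto simp: bas_def)+
  then show "adX1 p (bas (X i)) = (if 2 \<le> i \<and> i < p then bas (X (i + 1)) else (\<lambda>g. 0 :: 'a))"
    "adX1 p (bas (Y j)) = (if 1 \<le> j \<and> j < p then bas (Y (j + 1)) else (\<lambda>g. 0 :: 'a))"
    by blast+
qed

lemma adX1_lincomb: "adX1 p (\<lambda>g. c * x g + d * y g) = (\<lambda>g. c * adX1 p x g + d * adX1 p y g)"
  by (auto simp: adX1_def split: gen.splits)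

lemma adX1_smult: "adX1 p (\<lambda>g. c * x g) = (\<lambda>g. c * adX1 p x g)"
  by (auto simp: adX1_def split: gen.splits)

lemma adX1_add: "adX1 p (\<lambda>g. x g + y g) = (\<lambda>g. adX1 p x g + adX1 p y g)"
  by (auto simp: adX1_def split: gen.splits)

lemma adX1_Lpp [simp]: "adX1 p x \<in> Lpp p"
  by (auto simp: Lpp_def adX1_def split: gen.splits)

lemma adX1_hom_space: "x \<in> hom_space p e \<Longrightarrow> adX1 p x \<in> hom_space p e"
  by (auto simp: hom_space_def) (case_tac g; auto)

lemma adX1_expand: "adX1 p y g = (\<Sum>b\<in>gens p. y b * adX1 p (bas b) g)"
proof (cases g)
  case (X i)
  show ?thesis
  proof (cases "3 \<le> i \<and> i \<le> p")
    case True
    then have "(\<Sum>b\<in>gens p. y b * adX1 p (bas b) g) = (\<Sum>b\<in>gens p. bas (X (i - 1)) b * y b)"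
      by (intro sum.cong) (auto simp: X bas_def)
    then show ?thesis using True X by (subst (asm) sum_gens_bas) auto
  qed (auto simp: X)
next
  case (Y i)
  show ?thesis
  proof (cases "2 \<le> i \<and> i \<le> p")
    case True
    then have "(\<Sum>b\<in>gens p. y b * adX1 p (bas b) g) = (\<Sum>b\<in>gens p. bas (Y (i - 1)) b * y b)"
      by (intro sum.cong) (auto simp: Y bas_def)
    then show ?thesis using True Y by (subst (asm) sum_gens_bas) auto
  qed (auto simp: Y)
qed

lemma gen_bracket_eq:
  assumes "a \<in> gens p" "b \<in> gens p"
  shows "gen_bracket p a b g = bas (X 1) a * adX1 p (bas b) g - bas (X 1) b * (adX1 p (bas a) g :: 'a::field)"
proof -
  have X1: "bas (X (Suc 0)) (X i) = (if i = 1 then 1 else 0 :: 'a)" "bas (X (Suc 0)) (Y i) = (0 :: 'a)" for i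
    by (simp_all add: bas_def)
  show ?thesis
    using assms by (cases a; cases b) (auto simp: X1)
qed

lemma bracket_eq:
  assumes p: "p \<ge> 1"
  shows "bracket p x y = (\<lambda>g. x (X 1) * adX1 p y g + (- y (X 1)) * adX1 p x g)"
proof
  fix g
  have "bracket p x y g =
      (\<Sum>a\<in>gens p. \<Sum>b\<in>gens p. bas (X 1) a * (x a * (y b * adX1 p (bas b) g)))
      - (\<Sum>a\<in>gens p. \<Sum>b\<in>gens p. bas (X 1) b * (y b * (x a * adX1 p (bas a) g)))"
    by (simp add: bracket_def gen_bracket_eq sum_subtractf[symmetric] algebra_simps)
  also have "(\<Sum>a\<in>gens p. \<Sum>b\<in>gens p. bas (X 1) a * (x a * (y b * adX1 p (bas b) g))) = x (X 1) * adX1 p y g"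
    using p by (simp add: sum_distrib_left[symmetric] sum_gens_bas adX1_expand[of p y g])
  also have "(\<Sum>a\<in>gens p. \<Sum>b\<in>gens p. bas (X 1) b * (y b * (x a * adX1 p (bas a) g))) = y (X 1) * adX1 p x g"
    using p by (subst sum.swap) (simp add: sum_distrib_left[symmetric] sum_gens_bas adX1_expand[of p x g])
  finally show "bracket p x y g = x (X 1) * adX1 p y g + (- y (X 1)) * adX1 p x g" by simp
qed

text \<open>Up to sign, the action of \<open>X\<^sub>1\<close> on bilinear forms.\<close>

definition lieX1 :: "nat \<Rightarrow> ('a::field elt \<Rightarrow> 'a elt \<Rightarrow> 'a) \<Rightarrow> 'a elt \<Rightarrow> 'a elt \<Rightarrow> 'a" where
  "lieX1 p \<alpha> x y = \<alpha> (adX1 p x) y + \<alpha> x (adX1 p y)"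

lemma C2_bracket_left:
  "\<alpha> \<in> C2 p \<Longrightarrow> p \<ge> 1 \<Longrightarrow> \<alpha> (bracket p x y) z = x (X 1) * \<alpha> (adX1 p y) z - y (X 1) * \<alpha> (adX1 p x) z"
  using C1_lincomb[OF C2_right[of \<alpha> p z], of "adX1 p y" "adX1 p x" "x (X 1)" "- y (X 1)"]
  by (simp add: bracket_eq)

text \<open>A nonzero coordinate at X_1 forces its argument to be even. In every surviving term the
  remaining sign is therefore exactly the one that super-skew-symmetry produces when the two
  arguments of the form are exchanged.\<close>

lemma d2_hom_eq:
  assumes \<alpha>: "\<alpha> \<in> C2 p" and p: "p \<ge> 1" and e: "e1 \<in> {0, 1}" "e2 \<in> {0, 1}" "e3 \<in> {0, 1}"
    and x: "x \<in> hom_space p e1" and y: "y \<in> hom_space p e2" and z: "z \<in> hom_space p e3"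
  shows "d2_hom p \<alpha> e1 e2 e3 x y z =
    - x (X 1) * lieX1 p \<alpha> y z + y (X 1) * lieX1 p \<alpha> x z - z (X 1) * lieX1 p \<alpha> x y"
proof -
  have odd: "w \<in> hom_space p (Suc 0) \<Longrightarrow> w (X (Suc 0)) = 0" for w :: "'a elt"
    by (simp add: hom_space_def)
  have odd': "e1 = 1 \<Longrightarrow> x (X 1) = 0" "e2 = 1 \<Longrightarrow> y (X 1) = 0" "e3 = 1 \<Longrightarrow> z (X 1) = 0"
    using odd x y z by auto
  have skew: "\<alpha> (adX1 p v) u = - ((-1) ^ (i * j) * \<alpha> u (adX1 p v))"
    if "i \<in> {0, 1}" "j \<in> {0, 1}" "u \<in> hom_space p i" "v \<in> hom_space p j" for i j u v
    using C2_skew[OF \<alpha>, of j i "adX1 p v" u] that adX1_hom_space[of v p j] by (simp add: mult.commute)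
  show ?thesis
    using e skew[OF e(2,3) y z] skew[OF e(1,3) x z] skew[OF e(1,2) x y] odd'
    unfolding d2_hom_def C2_bracket_left[OF \<alpha> p] lieX1_def
    by (auto simp: algebra_simps)
qed

lemma lieX1_add:
  assumes \<alpha>: "\<alpha> \<in> C2 p" and L: "x \<in> Lpp p" "y \<in> Lpp p" "z \<in> Lpp p"
  shows "lieX1 p \<alpha> (\<lambda>g. x g + y g) z = lieX1 p \<alpha> x z + lieX1 p \<alpha> y z"
    and "lieX1 p \<alpha> z (\<lambda>g. x g + y g) = lieX1 p \<alpha> z x + lieX1 p \<alpha> z y"
  using L C1_add[OF C2_left[OF \<alpha>]] C1_add[OF C2_right[OF \<alpha>]]
  by (simp_all add: lieX1_def adX1_add)

lemma d2_eq:
  assumes \<alpha>: "\<alpha> \<in> C2 p" and p: "p \<ge> 1" and L: "x \<in> Lpp p" "y \<in> Lpp p" "z \<in> Lpp p"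
  shows "d2 p \<alpha> x y z = - x (X 1) * lieX1 p \<alpha> y z + y (X 1) * lieX1 p \<alpha> x z - z (X 1) * lieX1 p \<alpha> x y"
proof -
  have split: "lieX1 p \<alpha> u v = lieX1 p \<alpha> (hom_part 0 u) (hom_part 0 v) + lieX1 p \<alpha> (hom_part 0 u) (hom_part 1 v)
      + lieX1 p \<alpha> (hom_part 1 u) (hom_part 0 v) + lieX1 p \<alpha> (hom_part 1 u) (hom_part 1 v)"
    if "u \<in> Lpp p" "v \<in> Lpp p" for u v
  proof -
    note uv = that[THEN hom_part_Lpp, THEN hom_space_Lpp]
    have "lieX1 p \<alpha> (\<lambda>g. hom_part 0 u g + hom_part 1 u g) (\<lambda>g. hom_part 0 v g + hom_part 1 v g)
      = lieX1 p \<alpha> (hom_part 0 u) (hom_part 0 v) + lieX1 p \<alpha> (hom_part 0 u) (hom_part 1 v)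
      + lieX1 p \<alpha> (hom_part 1 u) (hom_part 0 v) + lieX1 p \<alpha> (hom_part 1 u) (hom_part 1 v)"
      by (subst lieX1_add(1)[OF \<alpha> uv(1) uv(1)], simp only: hom_part_sum that)
        (simp only: lieX1_add(2)[OF \<alpha> uv(2) uv(2) uv(1)] add.assoc)
    then show ?thesis by (simp only: hom_part_sum)
  qed
  have "hom_part 0 u (X 1) = u (X 1)" "hom_part 1 u (X 1) = 0" for u :: "'a elt"
    by (simp_all add: hom_part_def)
  then show ?thesis
    using L by (simp add: d2_def d2_hom_eq[OF \<alpha> p] hom_part_Lpp split algebra_simps)
qed

text \<open>By \<open>d2_eq\<close> the differential is, up to sign, the product of the coordinate
  form of X_1 with \<open>lieX1 p \<alpha>\<close>. Such a product vanishes iff its second factor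
  vanishes on the complementary ideal.\<close>

lemma d2_eq_zero_iff:
  assumes \<alpha>: "\<alpha> \<in> C2 p" and p: "p \<ge> 1"
  shows "d2 p \<alpha> = (\<lambda>x y z. 0) \<longleftrightarrow>
    (\<forall>a\<in>gens p - {X 1}. \<forall>b\<in>gens p - {X 1}. lieX1 p \<alpha> (bas a) (bas b) = 0)"
proof
  assume d2: "d2 p \<alpha> = (\<lambda>x y z. 0)"
  show "\<forall>a\<in>gens p - {X 1}. \<forall>b\<in>gens p - {X 1}. lieX1 p \<alpha> (bas a) (bas b) = 0"
  proof (intro ballI)
    fix a b assume ab: "a \<in> gens p - {X 1}" "b \<in> gens p - {X 1}"
    then have "(bas a :: 'a elt) (X 1) = 0" "(bas b :: 'a elt) (X 1) = 0" "(bas (X 1) :: 'a elt) (X 1) = 1"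
      by (auto simp: bas_def)
    then show "lieX1 p \<alpha> (bas a) (bas b) = 0"
      using d2_eq[OF \<alpha> p, of "bas (X 1)" "bas a" "bas b"] d2 ab p by simp
  qed
next
  assume inv: "\<forall>a\<in>gens p - {X 1}. \<forall>b\<in>gens p - {X 1}. lieX1 p \<alpha> (bas a) (bas b) = 0"
  \<comment> \<open>If the invariance defect vanishes off X_1, it is the wedge of the coordinate
    form of X_1 with \<open>h\<close>. Multiplying once more by that coordinate form makes the six
    terms cancel in pairs.\<close>
  define h where "h y = \<alpha> (bas (X 1)) (adX1 p y)" for y
  have h: "h y = (\<Sum>b\<in>gens p. y b * h (bas b))" if "y \<in> Lpp p" for y
  proof -
    have "(\<lambda>x. if x \<in> Lpp p then \<alpha> (bas (X 1)) (adX1 p x) else 0) \<in> C1 p"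
      using C1_add[OF C2_left[OF \<alpha>]] C1_smult[OF C2_left[OF \<alpha>]]
      by (simp add: C1_def Lpp_add adX1_add adX1_smult Lpp_smult)
    from C1_expand[OF this that] show ?thesis using that by (simp add: h_def)
  qed
  have gen: "lieX1 p \<alpha> (bas a) (bas b) = bas (X 1) a * h (bas b) - bas (X 1) b * h (bas a)"
    if ab: "a \<in> gens p" "b \<in> gens p" for a b
  proof -
    have "\<alpha> (adX1 p (bas a)) (bas (X 1)) = - \<alpha> (bas (X 1)) (adX1 p (bas a))"
      using C2_skew[OF \<alpha>, of "parity a" 0 "adX1 p (bas a)" "bas (X 1)"] ab p parity_cases[of a]
        bas_hom_space[of "X 1" p] adX1_hom_space[OF bas_hom_space[of a p]] by auto
    moreover have "bas (X (Suc 0)) g = (if g = X (Suc 0) then 1 else 0 :: 'a)" for g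
      by (simp add: bas_def)
    ultimately show ?thesis
      using ab inv C2_zero[OF \<alpha>] by (cases "a = X 1"; cases "b = X 1") (auto simp: lieX1_def h_def)
  qed
  have lie: "lieX1 p \<alpha> y z = y (X 1) * h z - z (X 1) * h y" if yz: "y \<in> Lpp p" "z \<in> Lpp p" for y z
  proof -
    have "lieX1 p \<alpha> y z = (\<Sum>a\<in>gens p. \<Sum>b\<in>gens p. y a * z b * lieX1 p \<alpha> (bas a) (bas b))"
    proof -
      have C1: "(\<lambda>x. if x \<in> Lpp p then \<alpha> (adX1 p x) w else 0) \<in> C1 p" "(\<lambda>x. if x \<in> Lpp p then \<alpha> w (adX1 p x) else 0) \<in> C1 p" for w
        using C1_add[OF C2_left[OF \<alpha>]] C1_smult[OF C2_left[OF \<alpha>]]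
          C1_add[OF C2_right[OF \<alpha>]] C1_smult[OF C2_right[OF \<alpha>]]
        by (simp_all add: C1_def Lpp_add adX1_add adX1_smult Lpp_smult)
      have ex: "\<alpha> (adX1 p u) w = (\<Sum>a\<in>gens p. u a * \<alpha> (adX1 p (bas a)) w)"
        "\<alpha> w (adX1 p u) = (\<Sum>a\<in>gens p. u a * \<alpha> w (adX1 p (bas a)))" if "u \<in> Lpp p" for u w
        using C1_expand[OF C1(1)[of w] that] C1_expand[OF C1(2)[of w] that] that by simp_all
      have "\<alpha> (adX1 p y) z = (\<Sum>a\<in>gens p. y a * (\<Sum>b\<in>gens p. z b * \<alpha> (adX1 p (bas a)) (bas b)))"
        by (subst ex(1)[OF yz(1)], intro sum.cong refl, subst C1_expand[OF C2_left[OF \<alpha>] yz(2)], rule refl)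
      moreover have "\<alpha> y (adX1 p z) = (\<Sum>a\<in>gens p. y a * (\<Sum>b\<in>gens p. z b * \<alpha> (bas a) (adX1 p (bas b))))"
        by (subst C1_expand[OF C2_right[OF \<alpha>] yz(1)], intro sum.cong refl, subst ex(2)[OF yz(2)], rule refl)
      ultimately show ?thesis
        by (simp only: lieX1_def sum.distrib sum_distrib_left distrib_left mult.assoc)
    qed
    also have "\<dots> = (\<Sum>a\<in>gens p. \<Sum>b\<in>gens p. bas (X 1) a * (y a * (z b * h (bas b))))
        - (\<Sum>a\<in>gens p. \<Sum>b\<in>gens p. bas (X 1) b * (z b * (y a * h (bas a))))"
      by (simp add: gen sum_subtractf[symmetric] algebra_simps)
    also have "(\<Sum>a\<in>gens p. \<Sum>b\<in>gens p. bas (X 1) a * (y a * (z b * h (bas b)))) = y (X 1) * h z"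
      using p by (simp add: sum_distrib_left[symmetric] sum_gens_bas h[OF yz(2)])
    also have "(\<Sum>a\<in>gens p. \<Sum>b\<in>gens p. bas (X 1) b * (z b * (y a * h (bas a)))) = z (X 1) * h y"
      using p by (subst sum.swap) (simp add: sum_distrib_left[symmetric] sum_gens_bas h[OF yz(1)])
    finally show ?thesis .
  qed
  show "d2 p \<alpha> = (\<lambda>x y z. 0)"
  proof (intro ext)
    fix x y z
    show "d2 p \<alpha> x y z = 0"
    proof (cases "x \<in> Lpp p \<and> y \<in> Lpp p \<and> z \<in> Lpp p")
      case True
      then show ?thesis by (simp add: d2_eq[OF \<alpha> p] lie algebra_simps)
    qed (auto simp: d2_def)
  qed
qed


subsection \<open>Iterated brackets of even elements\<close>

lemma adX1_pow_lincomb: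
  "(adX1 p ^^ k) (\<lambda>g. c * x g + d * y g) = (\<lambda>g. c * (adX1 p ^^ k) x g + d * (adX1 p ^^ k) y g)"
  by (induction k) (simp_all add: adX1_lincomb)

text \<open>The bound \<open>k \<ge> 1\<close> matters: one application already removes the X_1
  coordinate, which the identity would keep.\<close>

lemma adX1_pow_even:
  assumes "x \<in> Leven p" "k \<ge> 1"
  shows "(adX1 p ^^ k) x = (\<lambda>g. case g of X i \<Rightarrow> if k + 2 \<le> i \<and> i \<le> p then x (X (i - k)) else 0 | Y j \<Rightarrow> 0)"
  using assms(2)
proof (induction k rule: dec_induct)
  case base
  show ?case using assms(1) by (auto simp: adX1_def hom_space_def split: gen.splits)
next
  case (step k)
  show ?case
    unfolding funpow.simps o_def step.IH
    by (rule ext) (auto simp: adX1_def split: gen.splits)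
qed

lemma adX1_pow_top:
  assumes "x \<in> Leven p" "p \<ge> 3"
  shows "(adX1 p ^^ (p - 2)) x = (\<lambda>g. x (X 2) * bas (X p) g)"
proof -
  have "(adX1 p ^^ (p - 2)) x g = x (X 2) * bas (X p) g" for g
    using assms(2) adX1_pow_even[OF assms(1), of "p - 2"] by (cases g) (auto simp: bas_def)
  then show ?thesis by (rule ext)
qed

text \<open>Bracketing an element without X_1 coordinate with \<open>v\<close> is
  \<open>adX1\<close> scaled by \<open>- v (X 1)\<close>, and the result again has no X_1
  coordinate. So the further factors act by commuting scalars, and their order is
  irrelevant.\<close>

lemma foldl_bracket:
  assumes "p \<ge> 1" "z (X 1) = 0"
  shows "foldl (bracket p) z vs = (\<lambda>g. (\<Prod>v\<leftarrow>vs. - v (X 1)) * (adX1 p ^^ length vs) z g)"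
  using assms(2)
proof (induction vs arbitrary: z)
  case Nil
  then show ?case by simp
next
  case (Cons v vs)
  \<comment> \<open>The summand with coefficient 0 only brings \<open>z'\<close> into the shape of
    \<open>adX1_pow_lincomb\<close>.\<close>
  define z' where "z' = (\<lambda>g. (- v (X 1)) * adX1 p z g + 0 * z g)"
  have "bracket p z v = z'"
    using Cons.prems assms(1) by (simp add: bracket_eq z'_def)
  moreover have "z' (X 1) = 0" using Cons.prems by (simp add: z'_def)
  ultimately have "foldl (bracket p) z (v # vs) = (\<lambda>g. (\<Prod>v\<leftarrow>vs. - v (X 1)) * (adX1 p ^^ length vs) z' g)"
    using Cons.IH by simp
  moreover have "(adX1 p ^^ length vs) z' =
      (\<lambda>g. (- v (X 1)) * (adX1 p ^^ length vs) (adX1 p z) g + 0 * (adX1 p ^^ length vs) z g)"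
    unfolding z'_def by (rule adX1_pow_lincomb)
  ultimately show ?case by (simp add: funpow_swap1 mult.assoc mult.left_commute)
qed

lemma nbracket_even:
  assumes p: "p \<ge> 3" and x: "x \<in> Leven p" and y: "y \<in> Leven p" and len: "length vs = p - 3"
  shows "nbracket p (x # y # vs) =
    (\<lambda>g. (\<Prod>v\<leftarrow>vs. - v (X 1)) * (x (X 1) * y (X 2) - y (X 1) * x (X 2)) * bas (X p) g)"
proof -
  have "Suc (p - 3) = p - 2" using p by simp
  then have top: "(adX1 p ^^ (p - 3)) (adX1 p z) = (\<lambda>g. z (X 2) * bas (X p) g)" if "z \<in> Leven p" for z
    using adX1_pow_top[OF that p] by (metis funpow_Suc_right o_apply)
  have "nbracket p (x # y # vs) = foldl (bracket p) (bracket p x y) vs" by simp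
  also have "\<dots> = (\<lambda>g. (\<Prod>v\<leftarrow>vs. - v (X 1)) * (adX1 p ^^ length vs) (bracket p x y) g)"
    using p by (intro foldl_bracket) (simp_all add: bracket_eq)
  also have "\<dots> = (\<lambda>g. (\<Prod>v\<leftarrow>vs. - v (X 1)) * (x (X 1) * (y (X 2) * bas (X p) g) + (- y (X 1)) * (x (X 2) * bas (X p) g)))"
    using p by (simp only: bracket_eq len adX1_pow_lincomb top[OF x] top[OF y])
  finally show ?thesis by (simp add: algebra_simps)
qed

text \<open>The first p - 1 entries already give a multiple of X_p, which is central among even
  elements, so the last bracket is zero.\<close>

lemma nbracket_replicate:
  assumes p: "p \<ge> 3" and x: "x \<in> Leven p" and y: "y \<in> Leven p"
  shows "nbracket p (x # replicate (p - 1) y) = (\<lambda>g. 0)"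
proof -
  have eq: "x # replicate (p - 1) y = x # y # (replicate (p - 3) y @ [y])"
    using p by (cases p) (auto simp: replicate_append_same numeral_3_eq_3 Suc_diff_Suc simp flip: replicate_Suc)
  have "nbracket p (x # replicate (p - 1) y) = bracket p (nbracket p (x # y # replicate (p - 3) y)) y"
    unfolding eq by simp
  also have "\<dots> = (\<lambda>g. 0)"
    unfolding nbracket_even[OF p x y length_replicate]
    using p by (auto simp: bracket_eq adX1_smult) (simp add: bas_def)
  finally show ?thesis .
qed

lemma ind2_zero:
  assumes p: "p \<ge> 3" and \<alpha>: "\<alpha> \<in> C2 p" and lam: "\<forall>k\<in>{1..p}. lam k = 0"
  shows "ind2 p lam (\<alpha>, \<beta>) = (\<lambda>x y. 0)"
proof -
  have "pmap p lam y = (\<lambda>g. 0)" for y :: "'a elt" using lam by (simp add: pmap_def)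
  then show ?thesis
    by (intro ext) (simp only: ind2_def prod.case C2_zero[OF \<alpha>] nbracket_replicate[OF p] diff_self if_cancel cong: if_cong)
qed


subsection \<open>The sum in the star property\<close>

text \<open>Words are grouped by their number of letters \<open>True\<close>; the induction splits
  off the first letter and is Pascal's rule.\<close>

lemma sum_bool_lists:
  fixes f :: "nat \<Rightarrow> 'a::comm_semiring_1"
  shows "(\<Sum>v | length v = n. f (count_list v True)) = (\<Sum>j\<le>n. of_nat (n choose j) * f j)"
proof (induction n arbitrary: f)
  case 0
  then show ?case by simp
next
  case (Suc n)
  have "(\<Sum>v | length v = Suc n. f (count_list v True))
      = (\<Sum>(b, v)\<in>UNIV \<times> {v. length v = n}. f (count_list (b # v) True))"
    by (rule sum.reindex_bij_witness[of _ "\<lambda>(b, v). b # v" "\<lambda>v. (hd v, tl v)"])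
       (auto simp: length_Suc_conv)
  also have "\<dots> = (\<Sum>v | length v = n. f (Suc (count_list v True))) + (\<Sum>v | length v = n. f (count_list v True))"
    by (simp add: sum.cartesian_product[symmetric] UNIV_bool add.commute)
  also have "\<dots> = (\<Sum>j\<le>n. of_nat (n choose j) * f (Suc j)) + (\<Sum>j\<le>n. of_nat (n choose j) * f j)"
    using Suc.IH[of "\<lambda>j. f (Suc j)"] Suc.IH[of f] by simp
  also have "(\<Sum>j\<le>n. of_nat (n choose j) * f j) = (\<Sum>j\<le>Suc n. of_nat (n choose j) * f j)"
    by (simp add: binomial_eq_0)
  also have "\<dots> = f 0 + (\<Sum>j\<le>n. of_nat (n choose Suc j) * f (Suc j))"
    by (subst sum.atMost_Suc_shift) simp
  finally show ?case
    by (subst sum.atMost_Suc_shift) (simp add: sum.distrib algebra_simps)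
qed

lemma prod_list_bool:
  "(\<Prod>b\<leftarrow>v. if b then s else t) = s ^ count_list v True * (t :: 'a::comm_monoid_mult) ^ (length v - count_list v True)"
proof (induction v)
  case (Cons b v)
  have "count_list v True \<le> length v" by (rule count_le_length)
  then show ?case using Cons by (auto simp: Suc_diff_le ac_simps)
qed simp

text \<open>A word consists of the two fixed letters, p - 3 letters that act on their bracket by
  scalars, and a last letter that becomes the second argument of the form. Only the number
  \<open>j\<close> of middle letters equal to \<open>x\<close> matters, hence the binomial
  coefficient.\<close>

lemma star_sum_eq:
  fixes \<phi> :: "'a::field elt \<Rightarrow> 'a elt \<Rightarrow> 'a"
  assumes p: "p \<ge> 3" and \<phi>: "\<phi> \<in> C2 p" and x: "x \<in> Leven p" and y: "y \<in> Leven p"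
  shows "star_sum p \<phi> x y = (x (X 1) * y (X 2) - y (X 1) * x (X 2)) *
    (\<Sum>j\<le>p - 3. of_nat (p - 3 choose j) * ((- x (X 1)) ^ j * (- y (X 1)) ^ (p - 3 - j) *
      (\<phi> (bas (X p)) x / of_nat (j + 2) + \<phi> (bas (X p)) y / of_nat (j + 1))))"
proof -
  define c where "c b = (if b then x else y)" for b
  define \<Delta> where "\<Delta> = x (X 1) * y (X 2) - y (X 1) * x (X 2)"
  define F where "F w = (let v = map c w in
      1 / of_nat (count_list w True) * \<phi> (nbracket p (take (p - 1) v)) (v ! (p - 1)))" for w
  \<comment> \<open>The leading letter contributes 1 to the count of \<open>x\<close>, and the last
    letter contributes another 1 if it is \<open>x\<close>; this is the origin of the offsets 2 and
    1 in the denominators.\<close>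
  have F: "F (True # False # v @ [b]) = \<Delta> * ((- x (X 1)) ^ count_list v True * (- y (X 1)) ^ (p - 3 - count_list v True)
      * (\<phi> (bas (X p)) (c b) / of_nat (count_list v True + (if b then 2 else 1))))" if v: "length v = p - 3" for v b
  proof -
    have take: "take (p - 1) (map c (True # False # v @ [b])) = x # y # map c v"
      "map c (True # False # v @ [b]) ! (p - 1) = c b"
    proof -
      have p': "p - 1 = length (x # y # map c v)" using v p by simp
      have w: "map c (True # False # v @ [b]) = (x # y # map c v) @ [c b]" by (simp add: c_def)
      show "take (p - 1) (map c (True # False # v @ [b])) = x # y # map c v"
        "map c (True # False # v @ [b]) ! (p - 1) = c b"
        unfolding w p' by (simp_all only: append_eq_conv_conj[symmetric] take_append diff_self_eq_0 take0 nth_append_length) simp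
    qed
    have "\<phi> (nbracket p (x # y # map c v)) (c b) = (\<Prod>u\<leftarrow>map c v. - u (X 1)) * \<Delta> * \<phi> (bas (X p)) (c b)"
      using nbracket_even[OF p x y, of "map c v"] v p C1_smult[OF C2_right[OF \<phi>], of "bas (X p)"] by (simp add: \<Delta>_def)
    moreover have "(\<Prod>u\<leftarrow>map c v. - u (X 1)) = (\<Prod>b\<leftarrow>v. if b then - x (X 1) else - y (X 1))"
      unfolding map_map by (intro arg_cong[where f = prod_list] map_cong refl) (simp add: c_def)
    ultimately show ?thesis
      unfolding F_def Let_def take prod_list_bool v by (simp add: algebra_simps)
  qed
  have "star_sum p \<phi> x y = (\<Sum>w | length w = p \<and> w ! 0 = True \<and> w ! 1 = False. F w)"
  proof -
    have "c = (\<lambda>b. if b then x else y)" by (simp add: c_def fun_eq_iff)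
    then show ?thesis by (simp only: star_sum_def F_def)
  qed
  also have "\<dots> = (\<Sum>(v, b)\<in>{v. length v = p - 3} \<times> UNIV. F (True # False # v @ [b]))"
  proof (rule sum.reindex_bij_witness[of _ "\<lambda>(v, b). True # False # v @ [b]" "\<lambda>w. (butlast (tl (tl w)), last w)"])
    fix w assume w: "w \<in> {w. length w = p \<and> w ! 0 = True \<and> w ! 1 = False}"
    then obtain a b u where wu: "w = a # b # u" using p by (cases w; cases "tl w") auto
    moreover have "u \<noteq> []" using w wu p by auto
    ultimately show "(case (butlast (tl (tl w)), last w) of (v, b) \<Rightarrow> True # False # v @ [b]) = w"
      "(butlast (tl (tl w)), last w) \<in> {v. length v = p - 3} \<times> UNIV"
      "(case (butlast (tl (tl w)), last w) of (v, b) \<Rightarrow> F (True # False # v @ [b])) = F w"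
      using w by auto
  qed (use p in auto)
  also have "\<dots> = (\<Sum>v | length v = p - 3. F (True # False # v @ [True]) + F (True # False # v @ [False]))"
    by (simp add: sum.cartesian_product[symmetric] UNIV_bool add.commute)
  also have "\<dots> = (\<Sum>v | length v = p - 3. (\<lambda>j. \<Delta> * ((- x (X 1)) ^ j * (- y (X 1)) ^ (p - 3 - j) *
      (\<phi> (bas (X p)) x / of_nat (j + 2) + \<phi> (bas (X p)) y / of_nat (j + 1)))) (count_list v True))"
    by (intro sum.cong refl) (simp add: F c_def algebra_simps)
  also have "\<dots> = (\<Sum>j\<le>p - 3. of_nat (p - 3 choose j) * (\<Delta> * ((- x (X 1)) ^ j * (- y (X 1)) ^ (p - 3 - j) *
      (\<phi> (bas (X p)) x / of_nat (j + 2) + \<phi> (bas (X p)) y / of_nat (j + 1)))))"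
    by (rule sum_bool_lists)
  finally show ?thesis by (simp add: \<Delta>_def sum_distrib_left mult.left_commute)
qed


subsection \<open>Binomial coefficients in characteristic \<open>p\<close>\<close>

text \<open>Modulo p the coefficients of rows p - 1, p - 2, p - 3 are those of the exponents -1, -2,
  -3. Row p - 1 alternates because the inner coefficients of row p vanish, and Pascal's rule passes
  to the two rows above it. The factor 2 avoids a division in the last formula.\<close>

lemma choose_CHAR:
  assumes "CHAR('a::field) = p" "p > 2" "j < p"
  shows "of_nat (p - 1 choose j) = ((-1) ^ j :: 'a)"
    and "of_nat (p - 2 choose j) = ((-1) ^ j * of_nat (j + 1) :: 'a)"
    and "2 * of_nat (p - 3 choose j) = ((-1) ^ j * (of_nat (j + 1) * of_nat (j + 2)) :: 'a)"
proof -
  have prime: "prime p" using prime_CHAR_semidom[where 'a = 'a] assms by auto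
  have pascal: "(of_nat (n choose Suc j) :: 'a) = of_nat (n - 1 choose j) + of_nat (n - 1 choose Suc j)"
    if "n \<ge> 1" for n j
    using that by (cases n) simp_all
  have c1: "j < p \<Longrightarrow> of_nat (p - 1 choose j) = ((-1) ^ j :: 'a)" for j
  proof (induction j)
    case (Suc j)
    have "p dvd (p choose Suc j)" using prime Suc.prems by (intro dvd_choose_prime) auto
    then have "(of_nat (p choose Suc j) :: 'a) = 0"
      using assms(1) by (simp add: of_nat_eq_0_iff_char_dvd)
    then show ?case using Suc assms(2) pascal[of p j] by (simp add: add_eq_0_iff)
  qed simp
  have c2: "j < p \<Longrightarrow> of_nat (p - 2 choose j) = ((-1) ^ j * of_nat (j + 1) :: 'a)" for j
  proof (induction j)
    case (Suc j)
    have "p - 1 - 1 = p - 2" by simp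
    then show ?case using Suc assms(2) pascal[of "p - 1" j] c1[OF Suc.prems]
      by (simp add: algebra_simps eq_neg_iff_add_eq_0)
  qed simp
  have c3: "j < p \<Longrightarrow> 2 * of_nat (p - 3 choose j) = ((-1) ^ j * (of_nat (j + 1) * of_nat (j + 2)) :: 'a)" for j
  proof (induction j)
    case (Suc j)
    have "p - 2 - 1 = p - 3" by simp
    then have "2 * of_nat (p - 3 choose Suc j) =
        (2 * of_nat (p - 2 choose Suc j) - 2 * of_nat (p - 3 choose j) :: 'a)"
      using assms(2) pascal[of "p - 2" j] by simp
    then show ?case using Suc.IH Suc.prems c2[OF Suc.prems] by (simp add: algebra_simps)
  qed simp
  show "of_nat (p - 1 choose j) = ((-1) ^ j :: 'a)"
    "of_nat (p - 2 choose j) = ((-1) ^ j * of_nat (j + 1) :: 'a)"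
    "2 * of_nat (p - 3 choose j) = ((-1) ^ j * (of_nat (j + 1) * of_nat (j + 2)) :: 'a)"
    using c1 c2 c3 assms(3) by blast+
qed

text \<open>\<open>P\<close> is the derivative in \<open>t\<close> of \<open>t\<close> times
  \<open>Q\<close>. The closed forms are kept multiplied by \<open>b - t\<close>, so that
  \<open>b = t\<close> is allowed; in the application this is the case a + b = 0.\<close>

lemma geometric_sums:
  fixes b t :: "'a::comm_ring_1"
  defines "Q \<equiv> \<lambda>n. \<Sum>j\<le>n. t ^ j * b ^ (n - j)"
    and "P \<equiv> \<lambda>n. \<Sum>j\<le>n. of_nat (j + 1) * t ^ j * b ^ (n - j)"
  shows "Q (Suc n) = b * Q n + t ^ Suc n"
    and "P (Suc n) = b * P n + of_nat (n + 2) * t ^ Suc n"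
    and "(b - t) * Q n = b ^ Suc n - t ^ Suc n"
    and "(b - t) * P n = b * Q n - of_nat (n + 1) * t ^ Suc n"
proof -
  show Q: "Q (Suc n) = b * Q n + t ^ Suc n" for n
    by (simp add: Q_def sum_distrib_left Suc_diff_le algebra_simps)
  show P: "P (Suc n) = b * P n + of_nat (n + 2) * t ^ Suc n" for n
    by (simp add: P_def sum_distrib_left Suc_diff_le algebra_simps)
  have Q': "(b - t) * Q n = b ^ Suc n - t ^ Suc n" for n
  proof (induction n)
    case 0
    show ?case by (simp add: Q_def)
  next
    case (Suc n)
    have "(b - t) * Q (Suc n) = b * ((b - t) * Q n) + (b - t) * t ^ Suc n"
      by (simp add: Q algebra_simps)
    then show ?case unfolding Suc.IH by (simp add: algebra_simps)
  qed
  show "(b - t) * Q n = b ^ Suc n - t ^ Suc n" by (rule Q')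
  show "(b - t) * P n = b * Q n - of_nat (n + 1) * t ^ Suc n"
  proof (induction n)
    case 0
    show ?case by (simp add: Q_def P_def)
  next
    case (Suc n)
    have "(b - t) * P (Suc n) = b * ((b - t) * P n) + (b - t) * (of_nat (n + 2) * t ^ Suc n)"
      by (simp add: P algebra_simps)
    then show ?case unfolding Suc.IH by (simp add: Q algebra_simps)
  qed
qed

text \<open>With \<open>t = - a\<close> and \<open>n = p - 3\<close>, the values of the binomial coefficients modulo \<open>p\<close> turn twice the
  sum into \<open>P (A + B) + Q B\<close> for the geometric sums \<open>P\<close>, \<open>Q\<close> above, and they express
  \<open>(a + b)\<^sup>p\<^sup>-\<^sup>1\<close> and \<open>(a + b)\<^sup>p\<^sup>-\<^sup>2\<close> through \<open>Q\<close> and \<open>P\<close>.\<close>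

lemma star_polynomial_identity:
  fixes a b a2 b2 u1 u2 :: "'a::field"
  assumes char: "CHAR('a) = p" "p > 2"
  defines "A \<equiv> u1 * a + u2 * a2" and "B \<equiv> u1 * b + u2 * b2"
  shows "(a * b2 - b * a2) * (\<Sum>j\<le>p - 3. of_nat (p - 3 choose j) * ((- a) ^ j * (- b) ^ (p - 3 - j) *
      (A / of_nat (j + 2) + B / of_nat (j + 1)))) =
    (- u1 * (a + b) ^ (p - 1) * (a2 + b2) - u2 / 2 * (a + b) ^ (p - 2) * (a2 + b2) ^ 2)
    - (- u1 * a ^ (p - 1) * a2 - u2 / 2 * a ^ (p - 2) * a2 ^ 2)
    - (- u1 * b ^ (p - 1) * b2 - u2 / 2 * b ^ (p - 2) * b2 ^ 2)"
proof -
  have prime: "prime p" using prime_CHAR_semidom[where 'a = 'a] char by auto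
  then have odd: "odd p" using char(2) prime_odd_nat by blast
  define n where "n = p - 3"
  have n: "p = n + 3" "even n" using char(2) odd by (auto simp: n_def)
  have two: "(2::'a) \<noteq> 0"
    using char of_nat_eq_0_iff_char_dvd[of 2, where 'a = 'a] by (auto dest: dvd_imp_le)
  have p0: "of_nat n = (- 3 :: 'a)"
    using of_nat_CHAR[where 'a = 'a] char(1) n(1) by (simp add: eq_neg_iff_add_eq_0)
  let ?t = "- a"
  define Q where "Q n = (\<Sum>j\<le>n. ?t ^ j * b ^ (n - j))" for n
  define P where "P n = (\<Sum>j\<le>n. of_nat (j + 1) * ?t ^ j * b ^ (n - j))" for n
  note G = geometric_sums[where t = ?t and b = b, folded Q_def P_def]
  define S where "S = (\<Sum>j\<le>n. of_nat (n choose j) * ((- a) ^ j * (- b) ^ (n - j) *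
      (A / of_nat (j + 2) + B / of_nat (j + 1))))"
  have S: "2 * S = P n * (A + B) + Q n * B"
  proof -
    have "2 * (of_nat (n choose j) * ((- a) ^ j * (- b) ^ (n - j) * (A / of_nat (j + 2) + B / of_nat (j + 1))))
      = of_nat (j + 1) * ?t ^ j * b ^ (n - j) * (A + B) + ?t ^ j * b ^ (n - j) * B" if j: "j \<le> n" for j
    proof -
      have "\<not> p dvd (j + 1)" "\<not> p dvd (j + 2)" using j n by (auto dest!: dvd_imp_le)
      then have ne: "(of_nat (j + 1) :: 'a) \<noteq> 0" "(of_nat (j + 2) :: 'a) \<noteq> 0"
        using char(1) of_nat_eq_0_iff_char_dvd[where 'a = 'a] by blast+
      have c: "2 * of_nat (n choose j) = ((-1) ^ j * (of_nat (j + 1) * of_nat (j + 2)) :: 'a)"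
        using choose_CHAR(3)[OF char, of j] j n by simp
      define E where "E = A / of_nat (j + 2) + B / of_nat (j + 1)"
      have E: "(of_nat (j + 1) * of_nat (j + 2)) * E = of_nat (j + 1) * (A + B) + B"
      proof -
        have "(of_nat (j + 1) * of_nat (j + 2)) * E = of_nat (j + 1) * A + of_nat (j + 2) * B"
        proof -
          have "r * s * (A / s + B / r) = r * A + s * B" if "r \<noteq> 0" "s \<noteq> 0" for r s :: 'a
            using that by (simp add: field_simps)
          then show ?thesis using ne unfolding E_def by blast
        qed
        moreover have "of_nat (j + 2) * B = (of_nat (j + 1) + 1) * B" by simp
        ultimately show ?thesis by (simp only: distrib_left distrib_right mult_1 add.assoc)
      qed
      \<comment> \<open>Here the evenness of n = p - 3 enters: the sign of the binomial coefficient
        and that of the power of -b together have exponent n.\<close>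
      have sign: "(-1) ^ j * (- b) ^ (n - j) = b ^ (n - j)"
      proof -
        have "(- b) ^ (n - j) = (-1) ^ (n - j) * b ^ (n - j)" by (rule power_minus)
        moreover have "(-1) ^ j * (-1) ^ (n - j) = (1::'a)"
          using j n(2) by (simp add: power_add[symmetric])
        ultimately show ?thesis by (simp add: mult.assoc[symmetric])
      qed
      have "2 * (of_nat (n choose j) * (?t ^ j * (- b) ^ (n - j) * E)) =
          2 * of_nat (n choose j) * (?t ^ j * (- b) ^ (n - j) * E)" by (simp only: mult.assoc)
      also have "\<dots> = ?t ^ j * ((-1) ^ j * (- b) ^ (n - j)) * ((of_nat (j + 1) * of_nat (j + 2)) * E)"
        unfolding c by (simp only: ac_simps)
      also have "\<dots> = of_nat (j + 1) * ?t ^ j * b ^ (n - j) * (A + B) + ?t ^ j * b ^ (n - j) * B"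
        unfolding sign E by (simp only: distrib_left ac_simps)
      finally show ?thesis by (simp only: E_def)
    qed
    then have "2 * S = (\<Sum>j\<le>n. of_nat (j + 1) * ?t ^ j * b ^ (n - j) * (A + B) + ?t ^ j * b ^ (n - j) * B)"
      unfolding S_def sum_distrib_left by (intro sum.cong) auto
    also have "\<dots> = P n * (A + B) + Q n * B"
      by (simp only: P_def Q_def sum.distrib sum_distrib_right)
    finally show ?thesis .
  qed
  define k where "k = a ^ (p - 2)"
  define l where "l = b ^ (p - 2)"
  have tk: "?t ^ Suc n = - k" "b ^ Suc n = l" using n by (simp_all add: k_def l_def)
  have k1: "a ^ (p - 1) = a * k" "b ^ (p - 1) = b * l" using n by (simp_all add: k_def l_def)
  \<comment> \<open>As n + 1 = p - 2 is odd, the power of \<open>- a\<close> contributes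
    \<open>- k\<close>; the integer coefficients n + 1 and n + 2 become -2 and -1 by
    \<open>p0\<close>.\<close>
  have F1: "(a + b) * Q n = k + l"
    using G(3)[of n] unfolding tk by (simp add: algebra_simps)
  have F2: "(a + b) * P n = b * Q n - 2 * k"
    using G(4)[of n] p0 unfolding tk by (simp add: algebra_simps)
  have F3: "(a + b) ^ (p - 1) = b ^ 2 * Q n - k * b + a * k"
  proof -
    have "(a + b) ^ (p - 1) = (\<Sum>j\<le>p - 1. of_nat (p - 1 choose j) * a ^ j * b ^ (p - 1 - j))"
      by (rule binomial_ring)
    also have "\<dots> = Q (p - 1)"
      unfolding Q_def using choose_CHAR(1)[OF char] char(2)
      by (intro sum.cong) (simp_all add: power_minus[of a])
    also have "\<dots> = Q (Suc (Suc n))" using n by simp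
    also have "\<dots> = b * (b * Q n - k) + a * k"
      unfolding G(1) tk power_Suc[of _ "Suc n"] by simp
    finally show ?thesis by (simp add: algebra_simps power2_eq_square)
  qed
  have F4: "(a + b) ^ (p - 2) = b * P n + k"
  proof -
    have "(a + b) ^ (p - 2) = (\<Sum>j\<le>p - 2. of_nat (p - 2 choose j) * a ^ j * b ^ (p - 2 - j))"
      by (rule binomial_ring)
    also have "\<dots> = P (p - 2)"
      unfolding P_def using choose_CHAR(2)[OF char] char(2)
      by (intro sum.cong) (simp_all add: power_minus[of a])
    also have "\<dots> = P (Suc n)" using n by simp
    also have "\<dots> = b * P n + k"
      unfolding G(2) tk using p0 by simp
    finally show ?thesis .
  qed
  \<comment> \<open>The doubled identity is linear in \<open>u1\<close> and \<open>u2\<close>.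
    \<open>I1\<close> and \<open>I2\<close> are its two coefficients, obtained by replacing (A, B)
    with (a, b) and with (a2, b2).\<close>
  have I1: "(a * b2 - b * a2) * (P n * (a + b) + Q n * b) = 
      - 2 * ((a + b) ^ (p - 1) * (a2 + b2)) + 2 * (a * k * a2) + 2 * (b * l * b2)"
  proof -
    have PQ: "P n * (a + b) + Q n * b = 2 * (b * Q n - k)"
      using F2 by (simp add: mult.commute right_diff_distrib)
    have "(a * b2 - b * a2) * (P n * (a + b) + Q n * b) = 2 * (b2 * (a * b * Q n - a * k) - a2 * (b\<^sup>2 * Q n - b * k))"
      unfolding PQ by (simp add: power2_eq_square algebra_simps)
    also have "a * b * Q n - a * k = b * l - (a + b) ^ (p - 1)"
    proof -
      have "a * b * Q n = b * (k + l) - b\<^sup>2 * Q n"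
        unfolding F1[symmetric] by (simp add: power2_eq_square algebra_simps)
      then show ?thesis unfolding F3 by (simp add: algebra_simps)
    qed
    also have "b\<^sup>2 * Q n - b * k = (a + b) ^ (p - 1) - a * k"
      unfolding F3 by (simp add: algebra_simps)
    finally show ?thesis by (simp add: algebra_simps)
  qed
  have I2: "(a * b2 - b * a2) * (P n * (a2 + b2) + Q n * b2) =
      - ((a + b) ^ (p - 2) * (a2 + b2) ^ 2) + k * a2 ^ 2 + l * b2 ^ 2"
  proof -
    have aP: "a * P n = b * Q n - 2 * k - b * P n" and aQ: "a * Q n = k + l - b * Q n"
      using F1 F2 by (simp_all add: distrib_right eq_diff_eq)
    have "(a * b2 - b * a2) * (P n * (a2 + b2) + Q n * b2) =
        b2 ^ 2 * (a * P n + a * Q n) - a2 ^ 2 * (b * P n) + a2 * b2 * (a * P n - b * P n - b * Q n)"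
      by (simp add: power2_eq_square algebra_simps)
    then show ?thesis
      unfolding F4 aP aQ by (simp add: power2_eq_square algebra_simps)
  qed
  have "2 * ((a * b2 - b * a2) * S) = u1 * ((a * b2 - b * a2) * (P n * (a + b) + Q n * b))
      + u2 * ((a * b2 - b * a2) * (P n * (a2 + b2) + Q n * b2))"
  proof -
    have "2 * ((a * b2 - b * a2) * S) = (a * b2 - b * a2) * (2 * S)" by (rule mult.left_commute)
    then show ?thesis unfolding S A_def B_def by (simp add: algebra_simps)
  qed
  also have "\<dots> = 2 * ((- u1 * (a + b) ^ (p - 1) * (a2 + b2) - u2 / 2 * (a + b) ^ (p - 2) * (a2 + b2) ^ 2)
    - (- u1 * a ^ (p - 1) * a2 - u2 / 2 * a ^ (p - 2) * a2 ^ 2)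
    - (- u1 * b ^ (p - 1) * b2 - u2 / 2 * b ^ (p - 2) * b2 ^ 2))"
  proof -
    \<comment> \<open>Halving \<open>u2\<close> beforehand leaves a division-free identity for ring
      normalisation.\<close>
    define w where "w = u2 / 2"
    have u2: "u2 = 2 * w" using two by (simp add: w_def)
    show ?thesis
      unfolding I1 I2 k1 k_def[symmetric] l_def[symmetric] w_def[symmetric] unfolding u2
      by (simp add: algebra_simps)
  qed
  finally have "(a * b2 - b * a2) * S = (- u1 * (a + b) ^ (p - 1) * (a2 + b2) - u2 / 2 * (a + b) ^ (p - 2) * (a2 + b2) ^ 2)
    - (- u1 * a ^ (p - 1) * a2 - u2 / 2 * a ^ (p - 2) * a2 ^ 2)
    - (- u1 * b ^ (p - 1) * b2 - u2 / 2 * b ^ (p - 2) * b2 ^ 2)"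
    using two by (simp only: mult_cancel_left simp_thms)
  then show ?thesis by (simp only: S_def n_def)
qed


subsection \<open>The maps \<open>\<phi>\<^sub>*\<close>\<close>

lemma Leven_add: "x \<in> Leven p \<Longrightarrow> y \<in> Leven p \<Longrightarrow> (\<lambda>g. x g + y g) \<in> Leven p"
  for x :: "'a::field elt"
  by (simp add: hom_space_def Lpp_def)

lemma Leven_smult: "x \<in> Leven p \<Longrightarrow> (\<lambda>g. c * x g) \<in> Leven p"
  for x :: "'a::field elt"
  by (simp add: hom_space_def Lpp_def)

lemma bas_X_Leven: "1 \<le> i \<Longrightarrow> i \<le> p \<Longrightarrow> (bas (X i) :: 'a::field elt) \<in> Leven p"
  using bas_hom_space[of "X i" p] by simp

lemma semilinear_zero:
  fixes \<delta> :: "'a::field elt \<Rightarrow> 'a"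
  assumes p: "p \<ge> 1"
    and add: "\<And>x y. x \<in> Leven p \<Longrightarrow> y \<in> Leven p \<Longrightarrow> \<delta> (\<lambda>g. x g + y g) = \<delta> x + \<delta> y"
    and smult: "\<And>c x. x \<in> Leven p \<Longrightarrow> \<delta> (\<lambda>g. c * x g) = c ^ p * \<delta> x"
    and bas: "\<And>i. 1 \<le> i \<Longrightarrow> i \<le> p \<Longrightarrow> \<delta> (bas (X i)) = 0"
    and x: "x \<in> Leven p"
  shows "\<delta> x = 0"
proof -
  have "finite A \<Longrightarrow> A \<subseteq> {1..p} \<Longrightarrow>
      (\<lambda>g. if g \<in> X ` A then x g else 0) \<in> Leven p \<and> \<delta> (\<lambda>g. if g \<in> X ` A then x g else 0) = 0" for A
  proof (induction A rule: finite_induct)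
    case empty
    then show ?case
      using smult[OF x, of 0] p by (simp add: hom_space_def Lpp_def)
  next
    case (insert i A)
    have eq: "(\<lambda>g. if g \<in> X ` insert i A then x g else 0) =
        (\<lambda>g. x (X i) * bas (X i) g + (if g \<in> X ` A then x g else 0))"
      using insert.hyps by (auto simp: bas_def)
    show ?case unfolding eq
      using insert add[OF Leven_smult[OF bas_X_Leven]] smult[OF bas_X_Leven] bas
        Leven_add[OF Leven_smult[OF bas_X_Leven]] by auto
  qed
  from this[of "{1..p}"] have "\<delta> (\<lambda>g. if g \<in> X ` {1..p} then x g else 0) = 0" by simp
  moreover have "(if g \<in> X ` {1..p} then x g else 0) = x g" for g
    using x by (cases g) (auto simp: hom_space_def Lpp_def image_iff)
  ultimately show ?thesis by simp
qed

text \<open>Both maps have the same correction term in the star property, so it cancels in their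
  difference. What remains is p-semilinear and vanishes on the basis.\<close>

lemma star_property_unique:
  assumes p: "p \<ge> 1" and "star_property p \<phi> \<omega>" "star_property p \<phi> \<omega>'"
    and out: "\<forall>x. x \<notin> Leven p \<longrightarrow> \<omega> x = 0" "\<forall>x. x \<notin> Leven p \<longrightarrow> \<omega>' x = 0"
    and eq: "\<forall>i\<in>{1..p}. \<omega> (bas (X i)) = \<omega>' (bas (X i))"
  shows "\<omega> = \<omega>'"
proof
  fix x
  show "\<omega> x = \<omega>' x"
  proof (cases "x \<in> Leven p")
    case True
    have "\<omega> x - \<omega>' x = 0"
      by (rule semilinear_zero[OF p _ _ _ True])
        (use assms(2,3) eq in \<open>auto simp: star_property_def algebra_simps\<close>)
    then show ?thesis by simp
  qed (use out in simp)
qed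

text \<open>An explicit \<open>\<phi>\<^sub>*\<close> for forms with \<open>\<phi>(X\<^sub>p, X\<^sub>i) = 0\<close> for \<open>i \<ge> 3\<close>, found by solving the
  star property for a multiple of \<open>a\<^sub>1\<^sup>p\<^sup>-\<^sup>1 a\<^sub>2\<close> and of \<open>a\<^sub>1\<^sup>p\<^sup>-\<^sup>2 a\<^sub>2\<^sup>2\<close>.\<close>

definition star_form :: "nat \<Rightarrow> ('a::field elt \<Rightarrow> 'a elt \<Rightarrow> 'a) \<Rightarrow> 'a elt \<Rightarrow> 'a" where
  "star_form p \<phi> x = (if x \<in> Leven p then
     - \<phi> (bas (X p)) (bas (X 1)) * x (X 1) ^ (p - 1) * x (X 2)
     - \<phi> (bas (X p)) (bas (X 2)) / 2 * x (X 1) ^ (p - 2) * x (X 2) ^ 2 else 0)"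

lemma star_form_property:
  fixes \<phi> :: "'a::field elt \<Rightarrow> 'a elt \<Rightarrow> 'a"
  assumes char: "CHAR('a) = p" "p > 2" and \<phi>: "\<phi> \<in> C2 p"
    and top: "\<And>i. 3 \<le> i \<Longrightarrow> i \<le> p \<Longrightarrow> \<phi> (bas (X p)) (bas (X i)) = 0"
  shows "star_property p \<phi> (star_form p \<phi>)"
proof -
  \<comment> \<open>This is where \<open>top\<close> is used: the value at (X_p, x) involves only
    the coordinates at X_1 and X_2, which are the variables of the polynomial identity.\<close>
  have lin: "\<phi> (bas (X p)) x = \<phi> (bas (X p)) (bas (X 1)) * x (X 1) + \<phi> (bas (X p)) (bas (X 2)) * x (X 2)"
    if x: "x \<in> Leven p" for x
  proof -
    have "\<phi> (bas (X p)) x = (\<Sum>a\<in>gens p. x a * \<phi> (bas (X p)) (bas a))"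
      by (rule C1_expand[OF C2_left[OF \<phi>] hom_space_Lpp[OF x]])
    also have "\<dots> = (\<Sum>a\<in>{X 1, X 2}. x a * \<phi> (bas (X p)) (bas a))"
    proof (rule sum.mono_neutral_right)
      show "\<forall>a\<in>gens p - {X 1, X 2}. x a * \<phi> (bas (X p)) (bas a) = 0"
      proof
        fix a assume a: "a \<in> gens p - {X 1, X 2}"
        show "x a * \<phi> (bas (X p)) (bas a) = 0"
        proof (cases a)
          case (X i)
          then have "3 \<le> i" "i \<le> p" using a by (auto simp: numeral_3_eq_3 numeral_2_eq_2 not_less_eq_eq[symmetric] le_Suc_eq)
          then show ?thesis using X top by simp
        next
          case (Y i)
          then show ?thesis using x by (simp add: hom_space_def)
        qed
      qed
    qed (use char in auto)
    finally show ?thesis by (simp add: mult.commute)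
  qed
  have p3: "p \<ge> 3" using char by simp
  \<comment> \<open>Both monomials of \<open>star_form\<close> have total degree p, which gives the
    scaling by the p-th power of \<open>c\<close>.\<close>
  have "p = p - 1 + 1" "p = p - 2 + 2" using char(2) by simp_all
  then have pow: "c ^ p = c ^ (p - 1) * c" "c ^ p = c ^ (p - 2) * c ^ 2" for c :: 'a
    by (metis power_add power_one_right)+
  show ?thesis
    unfolding star_property_def
  proof (intro conjI allI ballI)
    fix c and x :: "'a elt" assume x: "x \<in> Leven p"
    have "(c * x (X 1)) ^ (p - 1) * (c * x (X 2)) = c ^ p * (x (X 1) ^ (p - 1) * x (X 2))"
      "(c * x (X 1)) ^ (p - 2) * (c * x (X 2)) ^ 2 = c ^ p * (x (X 1) ^ (p - 2) * x (X 2) ^ 2)"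
      by (simp add: pow(1) power_mult_distrib) (simp add: pow(2) power_mult_distrib)
    then show "star_form p \<phi> (\<lambda>g. c * x g) = c ^ p * star_form p \<phi> x"
      using x Leven_smult[OF x, of c] by (simp add: star_form_def mult.assoc right_diff_distrib mult.left_commute)
  next
    fix x y :: "'a elt" assume xy: "x \<in> Leven p" "y \<in> Leven p"
    show "star_form p \<phi> (\<lambda>g. x g + y g) = star_form p \<phi> x + star_form p \<phi> y + star_sum p \<phi> x y"
      unfolding star_sum_eq[OF p3 \<phi> xy] lin[OF xy(1)] lin[OF xy(2)] star_polynomial_identity[OF char]
      using xy Leven_add[OF xy] by (simp add: star_form_def)
  qed
qed

lemma star_form_bas: "p > 2 \<Longrightarrow> star_form p \<phi> (bas (X i)) = 0"
  by (auto simp: star_form_def bas_def power_0_left)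

text \<open>The explicit map supplies existence for the definite description. It vanishes at every
  basis vector since its monomials contain both the X_1 and the X_2 coordinate.\<close>

lemma star_of_eq:
  fixes \<phi> :: "'a::field elt \<Rightarrow> 'a elt \<Rightarrow> 'a"
  assumes char: "CHAR('a) = p" "p > 2" and \<phi>: "\<phi> \<in> C2 p"
    and top: "\<And>i. 3 \<le> i \<Longrightarrow> i \<le> p \<Longrightarrow> \<phi> (bas (X p)) (bas (X i)) = 0"
  shows "star_of p \<phi> = star_form p \<phi>"
  unfolding star_of_def
proof (rule the_equality)
  have sp: "star_property p \<phi> (star_form p \<phi>)" by (rule star_form_property[OF assms])
  show sf: "star_property p \<phi> (star_form p \<phi>) \<and> (\<forall>i\<in>{1..p}. star_form p \<phi> (bas (X i)) = 0)
      \<and> (\<forall>x. x \<notin> Leven p \<longrightarrow> star_form p \<phi> x = 0)"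
    using sp char by (simp add: star_form_bas) (simp add: star_form_def)
  fix \<omega> assume "star_property p \<phi> \<omega> \<and> (\<forall>i\<in>{1..p}. \<omega> (bas (X i)) = 0)
      \<and> (\<forall>x. x \<notin> Leven p \<longrightarrow> \<omega> x = 0)"
  then show "\<omega> = star_form p \<phi>"
    using sf char by (intro star_property_unique[of p \<phi>]) auto
qed


subsection \<open>Restricted cocycles and coboundaries\<close>

lemma star_sum_lincomb:
  "star_sum p (\<lambda>x y. c * \<phi> x y + d * \<psi> x y) x y = c * star_sum p \<phi> x y + d * star_sum p \<psi> x y"
  by (simp only: star_sum_def Let_def sum_distrib_left distrib_left sum.distrib mult.left_commute)

lemma star_property_lincomb:
  assumes "star_property p \<phi> \<omega>" "star_property p \<psi> \<chi>"
  shows "star_property p (\<lambda>x y. c * \<phi> x y + d * \<psi> x y) (\<lambda>x. c * \<omega> x + d * \<chi> x)"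
  using assms by (simp add: star_property_def star_sum_lincomb algebra_simps)

lemma lieX1_lincomb:
  "lieX1 p (\<lambda>x y. c * \<phi> x y + d * \<psi> x y) x y = c * lieX1 p \<phi> x y + d * lieX1 p \<psi> x y"
  by (simp add: lieX1_def algebra_simps)

lemma Ker_d2_star_iff:
  assumes "p \<ge> 3" "\<forall>k\<in>{1..p}. lam k = 0"
  shows "(\<phi>, \<omega>) \<in> Ker_d2_star p lam \<longleftrightarrow> \<phi> \<in> C2 p \<and> star_property p \<phi> \<omega> \<and> (\<forall>x. x \<notin> Leven p \<longrightarrow> \<omega> x = 0)
    \<and> (\<forall>a\<in>gens p - {X 1}. \<forall>b\<in>gens p - {X 1}. lieX1 p \<phi> (bas a) (bas b) = 0)"
  using assms d2_eq_zero_iff[of \<phi> p] ind2_zero[of p \<phi> lam \<omega>]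
  by (auto simp: Ker_d2_star_def C2_star_def d2_star_def)

lemma Ker_d2_star_lincomb:
  assumes "p \<ge> 3" "\<forall>k\<in>{1..p}. lam k = 0"
    and "(\<phi>, \<omega>) \<in> Ker_d2_star p lam" "(\<psi>, \<chi>) \<in> Ker_d2_star p lam"
  shows "(\<lambda>x y. c * \<phi> x y + d * \<psi> x y, \<lambda>x. c * \<omega> x + d * \<chi> x) \<in> Ker_d2_star p lam"
  using assms(3,4) unfolding Ker_d2_star_iff[OF assms(1,2)]
  by (simp add: C2_lincomb star_property_lincomb lieX1_lincomb)

lemma d1_eq:
  assumes p: "p \<ge> 1" and f: "f \<in> C1 p" and "x \<in> Lpp p" "y \<in> Lpp p"
  shows "d1 p f x y = y (X 1) * f (adX1 p x) - x (X 1) * f (adX1 p y)"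
  using C1_lincomb[OF f, of "adX1 p y" "adX1 p x" "x (X 1)" "- y (X 1)"] assms
  by (simp add: d1_def bracket_eq[OF p])

lemma d1_C2:
  assumes p: "p \<ge> 1" and f: "f \<in> C1 p"
  shows "d1 p f \<in> C2 p"
proof -
  have eq: "d1 p f = (\<lambda>x y. if x \<in> Lpp p \<and> y \<in> Lpp p then y (X 1) * f (adX1 p x) - x (X 1) * f (adX1 p y) else 0)"
    using d1_eq[OF p f] by (intro ext) (auto simp: d1_def)
  show ?thesis
    unfolding C2_def C1_def
    by (auto simp: eq Lpp_add Lpp_smult adX1_add adX1_smult C1_add[OF f] C1_smult[OF f] hom_space_Lpp algebra_simps)
      (auto simp: hom_space_def)
qed

lemma ind1_zero:
  assumes "f \<in> C1 p" "\<forall>k\<in>{1..p}. lam k = 0"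
  shows "ind1 p lam f = (\<lambda>x. 0)"
proof -
  have "pmap p lam y = (\<lambda>g. 0)" for y :: "'a elt" using assms(2) by (simp add: pmap_def)
  then show ?thesis by (intro ext) (simp add: ind1_def C1_zero[OF assms(1)])
qed

lemma d1_star_Ker:
  assumes p: "p \<ge> 3" and lam: "\<forall>k\<in>{1..p}. lam k = 0" and f: "f \<in> C1 p"
  shows "d1_star p lam f \<in> Ker_d2_star p lam"
proof -
  have C2: "d1 p f \<in> C2 p" using p by (intro d1_C2 f) simp
  \<comment> \<open>X_p is annihilated by \<open>adX1\<close> and has no X_1 coordinate, so the star
    sum of a coboundary is zero and the zero map has the star property for it.\<close>
  have top: "d1 p f (bas (X p)) x = 0" if "x \<in> Leven p" for x
  proof -
    have "adX1 p (bas (X p)) = (\<lambda>g. 0 :: 'a)" "bas (X p) (X 1) = (0 :: 'a)"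
      using p by (simp_all) (simp add: bas_def)
    then show ?thesis
      using p hom_space_Lpp[OF that] by (subst d1_eq[OF _ f]) (simp_all add: C1_zero[OF f])
  qed
  have "star_property p (d1 p f) (\<lambda>x. 0)"
    using p by (auto simp: star_property_def star_sum_eq[OF p C2] top)
  moreover have "lieX1 p (d1 p f) (bas a) (bas b) = 0" if "a \<in> gens p - {X 1}" "b \<in> gens p - {X 1}" for a b
  proof -
    have "bas a (X 1) = (0 :: 'a)" "bas b (X 1) = (0 :: 'a)" using that by (auto simp: bas_def)
    then show ?thesis using that p by (simp add: lieX1_def d1_eq[OF _ f])
  qed
  ultimately show ?thesis
    by (simp add: d1_star_def Ker_d2_star_iff[OF p lam] C2 ind1_zero[OF f lam])
qed

lemma Ker_vectorspace:
  fixes lam :: "nat \<Rightarrow> 'a::field"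
  assumes p: "p \<ge> 3" and lam: "\<forall>k\<in>{1..p}. lam k = 0"
  shows "vectorspace class_ring (C2_star_space p\<lparr>carrier := Ker_d2_star p lam\<rparr>)"
proof (intro vectorspace.intro module_criteria class_field)
  let ?M = "C2_star_space p\<lparr>carrier := Ker_d2_star p lam\<rparr>"
  note lincomb = Ker_d2_star_lincomb[OF p lam]
  show "cring (class_ring :: 'a ring)" by (rule class_cring.is_cring)
  show zero: "\<zero>\<^bsub>?M\<^esub> \<in> carrier ?M"
    using d1_star_Ker[OF p lam, of "\<lambda>x. 0"] lam
    by (simp add: C1_def d1_star_def d1_def ind1_def C2_star_space_def if_distrib cong: if_cong)
  show "\<forall>v w. v \<in> carrier ?M \<and> w \<in> carrier ?M \<longrightarrow> v \<oplus>\<^bsub>?M\<^esub> w \<in> carrier ?M"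
    using lincomb[of _ _ _ _ 1 1] by (auto simp: C2_star_space_def)
  show "\<forall>v\<in>carrier ?M. \<exists>w\<in>carrier ?M. v \<oplus>\<^bsub>?M\<^esub> w = \<zero>\<^bsub>?M\<^esub>"
  proof
    fix v assume v: "v \<in> carrier ?M"
    obtain \<phi> \<omega> where [simp]: "v = (\<phi>, \<omega>)" by fastforce
    show "\<exists>w\<in>carrier ?M. v \<oplus>\<^bsub>?M\<^esub> w = \<zero>\<^bsub>?M\<^esub>"
      using lincomb[of \<phi> \<omega> \<phi> \<omega> "-1" 0] v
      by (intro bexI[of _ "(\<lambda>x y. - \<phi> x y, \<lambda>x. - \<omega> x)"]) (auto simp: C2_star_space_def)
  qed
  show "\<forall>c v. c \<in> carrier class_ring \<and> v \<in> carrier ?M \<longrightarrow> c \<odot>\<^bsub>?M\<^esub> v \<in> carrier ?M"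
    using lincomb[of \<phi> \<omega> \<phi> \<omega> _ 0 for \<phi> \<omega>] by (auto simp: C2_star_space_def)
qed (auto simp: C2_star_space_def algebra_simps)

section \<open>Sign alternation and vanishing of invariant forms along antidiagonals\<close>

lemma antidiagonal:
  fixes m :: "nat \<Rightarrow> nat \<Rightarrow> 'a::comm_ring_1"
  assumes "\<And>r s. l \<le> r \<Longrightarrow> r < p \<Longrightarrow> l' \<le> s \<Longrightarrow> s < p \<Longrightarrow> m (Suc r) s = - m r (Suc s)"
    and "l \<le> r" "l' \<le> s" "r + k \<le> p" "s + k \<le> p"
  shows "m (r + k) s = (-1) ^ k * m r (s + k)"
  using assms(3-)
proof (induction k arbitrary: s)
  case (Suc k)
  have "m (r + Suc k) s = - m (r + k) (Suc s)" using assms(1)[of "r + k" s] assms(2) Suc.prems by simp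
  then show ?case using Suc.IH[of "Suc s"] Suc.prems by simp
qed simp

text \<open>Each step moves an entry one row up and one column to the right. It ends in the zero
  first row or leaves the last column, where the second assumption applies.\<close>

lemma antidiagonal_zero:
  fixes m :: "nat \<Rightarrow> nat \<Rightarrow> 'a::comm_ring_1"
  assumes "\<And>r s. l \<le> r \<Longrightarrow> r < p \<Longrightarrow> l' \<le> s \<Longrightarrow> s < p \<Longrightarrow> m (Suc r) s = - m r (Suc s)"
    and "\<And>r. l \<le> r \<Longrightarrow> r < p \<Longrightarrow> m (Suc r) p = 0"
    and "\<And>s. l' \<le> s \<Longrightarrow> s \<le> p \<Longrightarrow> m l s = 0"
    and "l \<le> r" "r \<le> p" "l' \<le> s" "s \<le> p"
  shows "m r s = 0"
  using assms(4-)
proof (induction r arbitrary: s rule: dec_induct)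
  case base
  then show ?case using assms(3) by simp
next
  case (step r)
  then show ?case using assms(1)[of r s] assms(2)[of r] by (cases "s = p") auto
qed

lemma eq_neg_self:
  assumes "(2::'a::idom) \<noteq> 0" "z = - z"
  shows "z = (0::'a)"
proof -
  have "2 * z = z + z" by (rule mult_2)
  also have "\<dots> = 0" using assms(2) by (simp add: eq_neg_iff_add_eq_0)
  finally show ?thesis using assms(1) by simp
qed

text \<open>In the \<open>XX\<close> and \<open>YY\<close> blocks the first-row entries on antidiagonals of the wrong parity vanish by
  (super-)symmetry; in the \<open>XY\<close> block the missing entry \<open>(X\<^sub>2, Y\<^sub>p)\<close> vanishes because
  \<open>D X\<^sub>p = 0\<close> at the other end of its antidiagonal.\<close>

lemma invariant_form_zero:
  fixes \<phi> :: "'a::field elt \<Rightarrow> 'a elt \<Rightarrow> 'a"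
  assumes p: "p \<ge> 3" and two: "(2::'a) \<noteq> 0" and \<phi>: "\<phi> \<in> C2 p"
    and inv: "\<And>a b. a \<in> gens p - {X 1} \<Longrightarrow> b \<in> gens p - {X 1} \<Longrightarrow> lieX1 p \<phi> (bas a) (bas b) = 0"
    and XX: "\<And>s. odd s \<Longrightarrow> 3 \<le> s \<Longrightarrow> s \<le> p \<Longrightarrow> \<phi> (bas (X 2)) (bas (X s)) = 0"
    and XY: "\<And>t. 1 \<le> t \<Longrightarrow> t < p \<Longrightarrow> \<phi> (bas (X 2)) (bas (Y t)) = 0"
    and YY: "\<And>t. odd t \<Longrightarrow> t \<le> p \<Longrightarrow> \<phi> (bas (Y 1)) (bas (Y t)) = 0"
    and ab: "a \<in> gens p - {X 1}" "b \<in> gens p - {X 1}"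
  shows "\<phi> (bas a) (bas b) = 0"
proof -
  note Z = C2_zero[OF \<phi>]
  note half = eq_neg_self[OF two]
  have skew: "\<phi> (bas a) (bas b) = - ((- 1) ^ (parity a * parity b) * \<phi> (bas b) (bas a))"
    if "a \<in> gens p" "b \<in> gens p" for a b using C2_bas_skew[OF \<phi> that] .
  have rel: "\<phi> (bas (X (Suc r))) (bas (X s)) = - \<phi> (bas (X r)) (bas (X (Suc s)))"
    if "2 \<le> r" "r < p" "2 \<le> s" "s < p" for r s
    using inv[of "X r" "X s"] that by (simp add: lieX1_def add_eq_0_iff)
  have rel0: "\<phi> (bas (X (Suc r))) (bas (X p)) = 0" if "2 \<le> r" "r < p" for r
    using inv[of "X r" "X p"] that by (simp add: lieX1_def Z)
  have XX2: "\<phi> (bas (X 2)) (bas (X s)) = 0" if s: "2 \<le> s" "s \<le> p" for s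
  proof (cases "odd s")
    case True
    then show ?thesis using XX[of s] s by (cases "s = 2") auto
  next
    case False
    have "\<phi> (bas (X (2 + (s - 2)))) (bas (X 2)) = (-1) ^ (s - 2) * \<phi> (bas (X 2)) (bas (X (2 + (s - 2))))"
      using antidiagonal[of 2 p 2 "\<lambda>r s. \<phi> (bas (X r)) (bas (X s))" 2 2 "s - 2", OF rel] s by simp
    moreover have "2 + (s - 2) = s" using s by simp
    ultimately have "\<phi> (bas (X s)) (bas (X 2)) = \<phi> (bas (X 2)) (bas (X s))" using s False by simp
    then show ?thesis using skew[of "X s" "X 2"] s by (intro half) simp
  qed
  have XX0: "\<phi> (bas (X r)) (bas (X s)) = 0" if "2 \<le> r" "r \<le> p" "2 \<le> s" "s \<le> p" for r s
    using antidiagonal_zero[of 2 p 2 "\<lambda>r s. \<phi> (bas (X r)) (bas (X s))", OF rel rel0 XX2] that by simp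
  have relXY: "\<phi> (bas (X (Suc r))) (bas (Y s)) = - \<phi> (bas (X r)) (bas (Y (Suc s)))"
    if "2 \<le> r" "r < p" "1 \<le> s" "s < p" for r s
    using inv[of "X r" "Y s"] that by (simp add: lieX1_def add_eq_0_iff)
  have relXY0: "\<phi> (bas (X (Suc r))) (bas (Y p)) = 0" if "2 \<le> r" "r < p" for r
    using inv[of "X r" "Y p"] that by (simp add: lieX1_def Z)
  have XY2: "\<phi> (bas (X 2)) (bas (Y t)) = 0" if t: "1 \<le> t" "t \<le> p" for t
  proof (cases "t = p")
    case True
    have "\<phi> (bas (X (2 + (p - 2)))) (bas (Y 2)) = (-1) ^ (p - 2) * \<phi> (bas (X 2)) (bas (Y (2 + (p - 2))))"
      using antidiagonal[of 2 p 1 "\<lambda>r s. \<phi> (bas (X r)) (bas (Y s))" 2 2 "p - 2", OF relXY] p by simp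
    moreover have "2 + (p - 2) = p" using p by simp
    moreover have "\<phi> (bas (X p)) (bas (Y 2)) = 0"
      using inv[of "X p" "Y 1"] p by (simp add: lieX1_def Z numeral_2_eq_2)
    ultimately show ?thesis using True by simp
  qed (use XY t in simp)
  have XY0: "\<phi> (bas (X r)) (bas (Y s)) = 0" if "2 \<le> r" "r \<le> p" "1 \<le> s" "s \<le> p" for r s
    using antidiagonal_zero[of 2 p 1 "\<lambda>r s. \<phi> (bas (X r)) (bas (Y s))", OF relXY relXY0 XY2] that by simp
  have relYY: "\<phi> (bas (Y (Suc r))) (bas (Y s)) = - \<phi> (bas (Y r)) (bas (Y (Suc s)))"
    if "1 \<le> r" "r < p" "1 \<le> s" "s < p" for r s
    using inv[of "Y r" "Y s"] that by (simp add: lieX1_def add_eq_0_iff)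
  have relYY0: "\<phi> (bas (Y (Suc r))) (bas (Y p)) = 0" if "1 \<le> r" "r < p" for r
    using inv[of "Y r" "Y p"] that by (simp add: lieX1_def Z)
  have YY1: "\<phi> (bas (Y 1)) (bas (Y t)) = 0" if t: "1 \<le> t" "t \<le> p" for t
  proof (cases "odd t")
    case False
    have "\<phi> (bas (Y (1 + (t - 1)))) (bas (Y 1)) = (-1) ^ (t - 1) * \<phi> (bas (Y 1)) (bas (Y (1 + (t - 1))))"
      using antidiagonal[of 1 p 1 "\<lambda>r s. \<phi> (bas (Y r)) (bas (Y s))" 1 1 "t - 1", OF relYY] t by simp
    moreover have "odd (t - 1)" using False t by simp
    ultimately have "\<phi> (bas (Y t)) (bas (Y 1)) = - \<phi> (bas (Y 1)) (bas (Y t))" using t by simp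
    then show ?thesis using skew[of "Y t" "Y 1"] t by (intro half) simp
  qed (use YY t in simp)
  have YY0: "\<phi> (bas (Y r)) (bas (Y s)) = 0" if "1 \<le> r" "r \<le> p" "1 \<le> s" "s \<le> p" for r s
    using antidiagonal_zero[of 1 p 1 "\<lambda>r s. \<phi> (bas (Y r)) (bas (Y s))", OF relYY relYY0 YY1] that by simp
  have ge2: "2 \<le> i" if "X i \<in> gens p - {X 1}" for i
    using that by (cases "i = 1") auto
  show ?thesis
  proof (cases a; cases b)
    fix i j assume "a = X i" "b = X j"
    then show ?thesis using ab ge2 XX0 by auto
  next
    fix i j assume "a = X i" "b = Y j"
    then show ?thesis using ab ge2 XY0 by auto
  next
    fix i j assume "a = Y i" "b = X j"
    then show ?thesis using ab ge2 XY0 skew[of a b] by auto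
  next
    fix i j assume "a = Y i" "b = Y j"
    then show ?thesis using ab YY0 by auto
  qed
qed


subsection \<open>The basis cocycles and their dual coordinates\<close>

lemma XX_bas:
  "a \<in> gens p \<Longrightarrow> b \<in> gens p \<Longrightarrow> (XX p i j (bas a) (bas b) :: 'a::field) =
    (if a = X i \<and> b = X j then 1 else if a = X j \<and> b = X i then -1 else 0)"
  by (simp add: XX_def bilinear_ext_bas)

lemma XY_bas:
  "a \<in> gens p \<Longrightarrow> b \<in> gens p \<Longrightarrow> (XY p k l (bas a) (bas b) :: 'a::field) =
    (if a = X k \<and> b = Y l then 1 else if a = Y l \<and> b = X k then -1 else 0)"
  by (simp add: XY_def bilinear_ext_bas)

lemma YY_bas:
  "a \<in> gens p \<Longrightarrow> b \<in> gens p \<Longrightarrow> (YY p s t (bas a) (bas b) :: 'a::field) =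
    (if a = Y s \<and> b = Y t \<or> a = Y t \<and> b = Y s then (if s = t then 2 else 1) else 0)"
  by (simp add: YY_def bilinear_ext_bas)

lemma XX_C2: "i \<noteq> j \<Longrightarrow> XX p i j \<in> C2 p"
  unfolding XX_def by (rule bilinear_ext_C2) auto

lemma XY_C2: "XY p k l \<in> C2 p"
  unfolding XY_def by (rule bilinear_ext_C2) auto

lemma YY_C2: "YY p s t \<in> C2 p"
  unfolding YY_def by (rule bilinear_ext_C2) auto

text \<open>Labels index the listed cocycles without presupposing that these are distinct.
  \<open>XXsum m\<close> stands for the form with index 2m + 3 and \<open>YYsum m\<close> for the
  one with index 2m, so that all ranges are intervals.\<close>

datatype label = XXtop | XYtop | XXsum nat | XYsum nat | YYsum nat | Star nat

definition labels :: "nat \<Rightarrow> label set" where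
  "labels p = {XXtop, XYtop} \<union> XXsum ` {1..(p - 1) div 2} \<union> XYsum ` {2..p}
    \<union> YYsum ` {1..(p + 1) div 2} \<union> Star ` {1..p}"

lemma finite_labels: "finite (labels p)"
  by (simp add: labels_def)

fun form :: "nat \<Rightarrow> label \<Rightarrow> 'a::field elt \<Rightarrow> 'a elt \<Rightarrow> 'a" where
  "form p XXtop = XX p 1 p"
| "form p XYtop = XY p 1 p"
| "form p (XXsum m) = varphi_c p (2 * m + 3)"
| "form p (XYsum j) = psi_c p j"
| "form p (YYsum m) = phi_c p (2 * m)"
| "form p (Star i) = (\<lambda>x y. 0)"

text \<open>In the order X before Y, and for both orders in the XX and YY blocks, a summed form
  takes the value (-1)^r along its whole antidiagonal, although the defining sums of these two
  blocks run over one half only.\<close>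

fun entry :: "nat \<Rightarrow> label \<Rightarrow> gen \<Rightarrow> gen \<Rightarrow> 'a::field" where
  "entry p XXtop (X r) (X s) = (if r = 1 \<and> s = p then 1 else if r = p \<and> s = 1 then -1 else 0)"
| "entry p XYtop (X r) (Y s) = (if r = 1 \<and> s = p then 1 else 0)"
| "entry p XYtop (Y s) (X r) = (if r = 1 \<and> s = p then -1 else 0)"
| "entry p (XXsum m) (X r) (X s) = (if r + s = 2 * m + 3 \<and> 2 \<le> r \<and> 2 \<le> s then (-1) ^ r else 0)"
| "entry p (XYsum j) (X r) (Y s) = (if r + s = j + 1 \<and> 2 \<le> r \<and> 1 \<le> s then (-1) ^ r else 0)"
| "entry p (XYsum j) (Y s) (X r) = (if r + s = j + 1 \<and> 2 \<le> r \<and> 1 \<le> s then - ((-1) ^ r) else 0)"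
| "entry p (YYsum m) (Y r) (Y s) = (if r + s = 2 * m \<and> 1 \<le> r \<and> 1 \<le> s then (-1) ^ r else 0)"
| "entry p _ _ _ = 0"

fun cocycle :: "nat \<Rightarrow> label \<Rightarrow> 'a::field rcochain2" where
  "cocycle p (Star i) = (\<lambda>x y. 0, X_star p i)"
| "cocycle p l = (form p l, star_of p (form p l))"

text \<open>Row 2 starts with sign (-1)^2 = 1 but row 1 with (-1)^1, hence the minus for
  \<open>YYsum\<close>. The column is the index sum of the antidiagonal minus the row.\<close>

fun coord :: "nat \<Rightarrow> label \<Rightarrow> 'a::field rcochain2 \<Rightarrow> 'a" where
  "coord p XXtop c = fst c (bas (X 1)) (bas (X p))"
| "coord p XYtop c = fst c (bas (X 1)) (bas (Y p))"
| "coord p (XXsum m) c = fst c (bas (X 2)) (bas (X (2 * m + 1)))"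
| "coord p (XYsum j) c = fst c (bas (X 2)) (bas (Y (j - 1)))"
| "coord p (YYsum m) c = - fst c (bas (Y 1)) (bas (Y (2 * m - 1)))"
| "coord p (Star i) c = snd c (bas (X i))"

text \<open>At a mirrored position skew-symmetry contributes -1, and since \<open>i\<close> is odd
  the exponents \<open>q\<close> and \<open>i - q\<close> have opposite parity; the two signs
  compensate.\<close>

lemma varphi_c_bas:
  assumes i: "odd i" and ab: "a \<in> gens p" "b \<in> gens p"
  shows "varphi_c p i (bas a) (bas b) = (case (a, b) of
    (X r, X s) \<Rightarrow> if r + s = i \<and> 2 \<le> r \<and> 2 \<le> s then (-1) ^ r else 0 | _ \<Rightarrow> (0 :: 'a::field))"
proof (cases "\<exists>r s. a = X r \<and> b = X s")
  case False
  then show ?thesis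
    using ab by (cases a; cases b) (auto simp: varphi_c_def XX_bas)
next
  case True
  then obtain r s where rs: "a = X r" "b = X s" by blast
  have "varphi_c p i (bas a) (bas b) =
      (\<Sum>q=2..i div 2. (if q = r \<and> r + s = i then (-1) ^ r else 0) + (if q = s \<and> r + s = i then (-1) ^ r else 0 :: 'a))"
    unfolding varphi_c_def
  proof (intro sum.cong refl)
    fix q assume q: "q \<in> {2..i div 2}"
    then have "2 \<le> q" "q \<le> i div 2" by simp_all
    then have ne: "q \<noteq> i - q" "q < i" using i by (presburger, linarith)
    have sign: "(-1) ^ (i - q) = (- ((-1) ^ q) :: 'a)"
    proof -
      have "odd q \<longleftrightarrow> even (i - q)" using i q by auto
      then show ?thesis by (cases "odd q") auto
    qed
    consider "q = r" "s = i - q" | "q = s" "r = i - q" | "r + s \<noteq> i \<or> q \<noteq> r \<and> q \<noteq> s"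
      using ne by fastforce
    then show "(-1) ^ q * XX p q (i - q) (bas a) (bas b) =
        (if q = r \<and> r + s = i then (-1) ^ r else 0) + (if q = s \<and> r + s = i then (-1) ^ r else 0 :: 'a)"
    proof cases
      case 1
      then show ?thesis using ab ne by (auto simp: XX_bas rs)
    next
      case 2
      then have "XX p q (i - q) (bas a) (bas b) = (-1 :: 'a)" using ab ne by (auto simp: XX_bas rs)
      then show ?thesis using 2 ne sign by auto
    next
      case 3
      have "\<not> (r = q \<and> s = i - q)" "\<not> (r = i - q \<and> s = q)" using 3 ne(2) by linarith+
      then have "XX p q (i - q) (bas a) (bas b) = (0 :: 'a)" using ab by (simp add: XX_bas rs)
      then show ?thesis using 3 by auto
    qed
  qed
  also have "\<dots> = (if r + s = i \<and> r \<in> {2..i div 2} then (-1) ^ r else 0)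
      + (if r + s = i \<and> s \<in> {2..i div 2} then (-1) ^ r else 0)"
    by (cases "r + s = i") (simp_all add: sum.distrib)
  also have "\<dots> = (if r + s = i \<and> 2 \<le> r \<and> 2 \<le> s then (-1) ^ r else 0)"
  proof (cases "r + s = i")
    case True
    with i have "(r \<le> i div 2 \<and> \<not> s \<le> i div 2) \<or> (s \<le> i div 2 \<and> \<not> r \<le> i div 2)" "r \<noteq> s" by presburger+
    then show ?thesis using True i by auto
  qed simp
  finally show ?thesis by (simp add: rs)
qed

lemma psi_c_bas:
  assumes ab: "a \<in> gens p" "b \<in> gens p"
  shows "psi_c p j (bas a) (bas b) = (case (a, b) of
    (X r, Y s) \<Rightarrow> if r + s = j + 1 \<and> 2 \<le> r \<and> 1 \<le> s then (-1) ^ r else 0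
  | (Y s, X r) \<Rightarrow> if r + s = j + 1 \<and> 2 \<le> r \<and> 1 \<le> s then - ((-1) ^ r) else 0
  | _ \<Rightarrow> (0 :: 'a::field))"
proof -
  have pick: "(\<Sum>q=2..j. (-1) ^ q * (if r = q \<and> s = j - q + 1 then c else 0)) =
      (if r + s = j + 1 \<and> 2 \<le> r \<and> 1 \<le> s then (-1) ^ r * c else (0::'a))" for r s c
  proof -
    have "(\<Sum>q=2..j. (-1) ^ q * (if r = q \<and> s = j - q + 1 then c else 0)) =
        (\<Sum>q=2..j. if q = r then (if s = j - r + 1 then (-1) ^ r * c else 0) else 0)"
      by (rule sum.cong) auto
    then show ?thesis by auto
  qed
  show ?thesis
    using ab pick[where c = 1] pick[where c = "-1"]
    by (cases a; cases b) (simp_all add: psi_c_def XY_bas conj_commute cong: if_cong)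
qed

text \<open>Here symmetry and the even index sum preserve the sign under mirroring. The coefficient
  1/2 of the middle term offsets the value 2 of the form \<open>YY\<close> on its diagonal.\<close>

lemma phi_c_bas:
  assumes two: "(2::'a::field) \<noteq> 0" and m: "m \<ge> 1" and ab: "a \<in> gens p" "b \<in> gens p"
  shows "phi_c p (2 * m) (bas a) (bas b) = (case (a, b) of
    (Y r, Y s) \<Rightarrow> if r + s = 2 * m \<and> 1 \<le> r \<and> 1 \<le> s then (-1) ^ r else 0 | _ \<Rightarrow> (0 :: 'a))"
proof (cases "\<exists>r s. a = Y r \<and> b = Y s")
  case False
  then show ?thesis
    using ab by (cases a; cases b) (auto simp: phi_c_def YY_bas)
next
  case True
  then obtain r s where rs: "a = Y r" "b = Y s" by blast
  have "(\<Sum>t=1..m - 1. (-1) ^ t * YY p t (2 * m - t) (bas a) (bas b)) =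
      (\<Sum>t=1..m - 1. (if t = r then (if r + s = 2 * m then (-1) ^ r else 0) else 0)
        + (if t = s then (if r + s = 2 * m then (-1) ^ r else 0) else 0 :: 'a))"
  proof (intro sum.cong refl)
    fix t assume t: "t \<in> {1..m - 1}"
    then have ne: "t \<noteq> 2 * m - t" "t < 2 * m" by auto
    have sign: "(-1) ^ (2 * m - t) = ((-1) ^ t :: 'a)"
    proof -
      have "odd t \<longleftrightarrow> odd (2 * m - t)" using t by auto
      then show ?thesis by (cases "odd t") auto
    qed
    consider "t = r" "s = 2 * m - t" | "t = s" "r = 2 * m - t" | "r + s \<noteq> 2 * m \<or> t \<noteq> r \<and> t \<noteq> s"
      using ne by fastforce
    then show "(-1) ^ t * YY p t (2 * m - t) (bas a) (bas b) =
      (if t = r then (if r + s = 2 * m then (-1) ^ r else 0) else 0)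
        + (if t = s then (if r + s = 2 * m then (-1) ^ r else 0) else 0 :: 'a)"
    proof cases
      case 1
      then show ?thesis using ab ne by (auto simp: YY_bas rs)
    next
      case 2
      then have "YY p t (2 * m - t) (bas a) (bas b) = (1 :: 'a)" using ab ne by (auto simp: YY_bas rs)
      then show ?thesis using 2 ne sign by auto
    next
      case 3
      have "\<not> (r = t \<and> s = 2 * m - t)" "\<not> (r = 2 * m - t \<and> s = t)" using 3 ne(2) by linarith+
      then have "YY p t (2 * m - t) (bas a) (bas b) = (0 :: 'a)" using ab ne(1) by (auto simp: YY_bas rs)
      then show ?thesis using 3 by auto
    qed
  qed
  also have "\<dots> = (if r + s = 2 * m \<and> r \<in> {1..m - 1} then (-1) ^ r else 0)
      + (if r + s = 2 * m \<and> s \<in> {1..m - 1} then (-1) ^ r else 0)"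
    by (cases "r + s = 2 * m") (simp_all add: sum.distrib)
  finally have sum: "(\<Sum>t=1..m - 1. (-1) ^ t * YY p t (2 * m - t) (bas a) (bas b)) = \<dots>" .
  have mid: "(-1) ^ m * (1 / 2) * YY p m m (bas a) (bas b) = (if r = m \<and> s = m then (-1) ^ r else 0 :: 'a)"
    using two ab by (auto simp: YY_bas rs)
  consider "r + s \<noteq> 2 * m" | "r + s = 2 * m" "r < m" "s > m" | "r + s = 2 * m" "r > m" "s < m" | "r = m" "s = m"
    by linarith
  moreover have "phi_c p (2 * m) (bas a) (bas b) =
      (if r + s = 2 * m \<and> r \<in> {1..m - 1} then (-1) ^ r else 0)
      + (if r + s = 2 * m \<and> s \<in> {1..m - 1} then (-1) ^ r else 0)
      + (if r = m \<and> s = m then (-1) ^ r else 0 :: 'a)"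
    unfolding phi_c_def nonzero_mult_div_cancel_left[OF zero_neq_numeral[symmetric]] sum mid ..
  ultimately show ?thesis
    using ab m by cases (auto simp: rs)
qed

lemma form_bas:
  assumes "(2::'a::field) \<noteq> 0" "l \<in> labels p" "a \<in> gens p" "b \<in> gens p"
  shows "form p l (bas a) (bas b) = (entry p l a b :: 'a)"
proof (cases l)
  case XXtop
  then show ?thesis using assms by (cases a; cases b) (simp_all add: XX_bas)
next
  case XYtop
  then show ?thesis using assms by (cases a; cases b) (simp_all add: XY_bas)
next
  case (XXsum m)
  then show ?thesis using assms varphi_c_bas[of "2 * m + 3" a p b] by (cases a; cases b) simp_all
next
  case (XYsum m)
  then show ?thesis using assms psi_c_bas[of a p b m] by (cases a; cases b) simp_all
next
  case (YYsum m)
  then show ?thesis using assms phi_c_bas[of m a p b] by (cases a; cases b) (auto simp: labels_def)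
qed simp

lemma form_C2: "form p l \<in> C2 p" if "p \<ge> 3" "l \<in> labels p"
proof (cases l)
  case XXtop
  then show ?thesis using that by (simp add: XX_C2)
next
  case (XXsum m)
  have "q \<noteq> 2 * m + 3 - q" for q by presburger
  then show ?thesis unfolding XXsum form.simps varphi_c_def by (intro C2_sum) (auto intro: XX_C2)
next
  case (XYsum j)
  show ?thesis unfolding XYsum form.simps psi_c_def by (intro C2_sum) (auto intro: XY_C2)
next
  case (YYsum m)
  show ?thesis
    unfolding YYsum form.simps phi_c_def
    using C2_lincomb[OF C2_sum[of "{1..2 * m div 2 - 1}" "\<lambda>t. YY p t (2 * m - t)" p "\<lambda>t. (-1) ^ t"]
        YY_C2[of p "2 * m div 2" "2 * m div 2"], of 1 "(-1) ^ (2 * m div 2) * (1 / 2)"]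
    by (simp add: YY_C2)
qed (simp_all add: XY_C2 C2_zero_form)

text \<open>The two shifted entries are neighbours on one antidiagonal and cancel. At the border
  index p only one is left, and its index sum exceeds the bound p + 2 (XX) or p + 1 (XY, YY) set by
  the labels.\<close>

lemma form_invariant:
  assumes p: "p \<ge> 3" "odd p" and two: "(2::'a::field) \<noteq> 0" and l: "l \<in> labels p"
    and ab: "a \<in> gens p - {X 1}" "b \<in> gens p - {X 1}"
  shows "lieX1 p (form p l) (bas a) (bas b) = (0 :: 'a)"
proof -
  note Z = C2_zero[OF form_C2[OF p(1) l]]
  note F = form_bas[OF two l]
  have ge2: "2 \<le> i" if "X i \<in> gens p - {X 1}" for i
    using that by (cases "i = 1") auto
  have left: "form p l (adX1 p (bas a)) (bas b) = (case a of
      X r \<Rightarrow> if r < p then entry p l (X (r + 1)) b else 0 | Y r \<Rightarrow> if r < p then entry p l (Y (r + 1)) b else (0 :: 'a))"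
    using ab ge2 by (cases a) (auto simp: Z F)
  have right: "form p l (bas a) (adX1 p (bas b)) = (case b of
      X r \<Rightarrow> if r < p then entry p l a (X (r + 1)) else 0 | Y r \<Rightarrow> if r < p then entry p l a (Y (r + 1)) else (0 :: 'a))"
    using ab ge2 by (cases b) (auto simp: Z F)
  have range: "a = X r \<Longrightarrow> 2 \<le> r \<and> r \<le> p" "a = Y r \<Longrightarrow> 1 \<le> r \<and> r \<le> p"
    "b = X r \<Longrightarrow> 2 \<le> r \<and> r \<le> p" "b = Y r \<Longrightarrow> 1 \<le> r \<and> r \<le> p" for r
    using ab ge2 by auto
  show ?thesis
  proof (cases l)
    case XXtop
    then show ?thesis using range unfolding lieX1_def left right by (cases a; cases b) auto
  next
    case XYtop
    then show ?thesis using range unfolding lieX1_def left right by (cases a; cases b) auto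
  next
    case (XXsum m)
    then have "2 * m + 3 \<le> p + 2" using l by (auto simp: labels_def)
    then show ?thesis using XXsum range unfolding lieX1_def left right by (cases a; cases b) auto
  next
    case (XYsum m)
    then have "m \<le> p" using l by (auto simp: labels_def)
    then show ?thesis using XYsum range unfolding lieX1_def left right by (cases a; cases b) auto
  next
    case (YYsum m)
    then have "2 * m \<le> p + 1" using l p(2) by (auto simp: labels_def elim!: oddE)
    then show ?thesis using YYsum range unfolding lieX1_def left right by (cases a; cases b) auto
  qed (simp add: lieX1_def)
qed

lemma form_top:
  assumes p: "p \<ge> 3" "odd p" and two: "(2::'a::field) \<noteq> 0" and l: "l \<in> labels p"
    and i: "3 \<le> i" "i \<le> p"
  shows "form p l (bas (X p)) (bas (X i)) = (0 :: 'a)"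
proof -
  have "l = XXsum m \<Longrightarrow> 2 * m + 3 \<le> p + 2" for m
    using l p(2) by (auto simp: labels_def)
  moreover have "form p l (bas (X p)) (bas (X i)) = (entry p l (X p) (X i) :: 'a)"
    using i p by (intro form_bas[OF two l]) auto
  ultimately show ?thesis using i p by (cases l) auto
qed

lemma X_star_property:
  assumes p: "CHAR('a::field) = p" "p > 2"
  shows "star_property p (\<lambda>x y. 0) (X_star p i :: 'a elt \<Rightarrow> 'a)"
proof -
  have "prime p" using prime_CHAR_semidom[where 'a = 'a] p by auto
  then have "(a + b) ^ p = a ^ p + b ^ p" for a b :: 'a
    using freshmans_dream[where 'a = 'a] p by auto
  then show ?thesis
    by (auto simp: star_property_def X_star_def Leven_add Leven_smult power_mult_distrib star_sum_def)
qed

lemma cocycle_labels: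
  assumes p_odd: "odd p"
  shows "cocycle p ` labels p = (cocycle_list p :: 'a::field rcochain2 set)"
proof -
  have odds: "{i. odd i \<and> 5 \<le> i \<and> i \<le> p + 2} = (\<lambda>m. 2 * m + 3) ` {1..(p - 1) div 2}"
  proof (intro Set.set_eqI iffI)
    fix i assume "i \<in> {i. odd i \<and> 5 \<le> i \<and> i \<le> p + 2}"
    moreover from this obtain m where "i = 2 * m + 1" by (auto elim: oddE)
    ultimately show "i \<in> (\<lambda>m. 2 * m + 3) ` {1..(p - 1) div 2}" by (intro image_eqI[of _ _ "m - 1"]) auto
  qed (use p_odd in auto)
  have evens: "{k. even k \<and> 2 \<le> k \<and> k \<le> p + 1} = (\<lambda>m. 2 * m) ` {1..(p + 1) div 2}"
    by (auto elim!: evenE)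
  have "cocycle_list p = (\<lambda>\<phi>. (\<phi>, star_of p \<phi>)) ` Omega4 p \<union> (\<lambda>i. (\<lambda>x y. 0, X_star p i)) ` {1..p}"
    by (auto simp: cocycle_list_def)
  also have "\<dots> = cocycle p ` labels p"
    unfolding Omega4_def odds evens labels_def image_Un image_insert image_image image_empty by simp
  finally show ?thesis by (rule sym)
qed

lemma card_labels:
  assumes "odd p"
  shows "card (labels p) = 3 * p + 1"
proof -
  have inj: "inj_on XXsum A" "inj_on XYsum A" "inj_on YYsum A" "inj_on Star A" for A
    by (auto simp: inj_on_def)
  have disj: "XXsum ` A \<inter> XYsum ` B = {}" "XXsum ` A \<inter> YYsum ` B = {}" "XXsum ` A \<inter> Star ` B = {}"
    "XYsum ` A \<inter> YYsum ` B = {}" "XYsum ` A \<inter> Star ` B = {}" "YYsum ` A \<inter> Star ` B = {}" for A B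
    by auto
  have "card (labels p) = 2 + (p - 1) div 2 + (p - 1) + (p + 1) div 2 + p"
    by (simp add: labels_def card_insert_if image_iff card_Un_disjoint Int_Un_distrib2 disj card_image inj)
  then show ?thesis using assms by (elim oddE) simp
qed

lemma CHAR_gt_2:
  assumes "CHAR('a::field) = p" "p > 2"
  shows "p \<ge> 3" "odd p" "(2::'a) \<noteq> 0"
proof -
  have "prime p" using prime_CHAR_semidom[where 'a = 'a] assms by auto
  then show "p \<ge> 3" "odd p" using assms(2) prime_odd_nat by auto
  show "(2::'a) \<noteq> 0"
    using assms of_nat_eq_0_iff_char_dvd[of 2, where 'a = 'a] by (auto dest: dvd_imp_le)
qed

section \<open>The coboundaries and the dual family of cocycles\<close>

context
  fixes p :: nat and lam :: "nat \<Rightarrow> 'a::field"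
  assumes char: "CHAR('a) = p" "p > 2" and lam: "\<forall>k\<in>{1..p}. lam k = 0"
begin

lemmas p_odd = CHAR_gt_2(1,2)[OF char]
lemmas two_neq_zero = CHAR_gt_2(3)[OF char]

text \<open>From here on the definite description is replaced by the explicit
  \<open>star_form\<close>, which vanishes on the basis and so has zero \<open>Star\<close>
  coordinates.\<close>

lemma cocycle_not_Star:
  assumes "l \<in> labels p" "\<forall>i. l \<noteq> Star i"
  shows "cocycle p l = (form p l, star_form p (form p l) :: 'a elt \<Rightarrow> 'a)"
  using assms star_of_eq[OF char form_C2[OF p_odd(1) assms(1)] form_top[OF p_odd two_neq_zero assms(1)]]
  by (cases l) auto

lemma cocycle_Ker: "l \<in> labels p \<Longrightarrow> cocycle p l \<in> Ker_d2_star p lam"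
proof -
  assume l: "l \<in> labels p"
  show ?thesis
  proof (cases "\<exists>i. l = Star i")
    case True
    then show ?thesis
      using X_star_property[OF char]
      by (auto simp: Ker_d2_star_iff[OF p_odd(1) lam] C2_zero_form lieX1_def X_star_def)
  next
    case False
    then have eq: "cocycle p l = (form p l, star_form p (form p l) :: 'a elt \<Rightarrow> 'a)"
      using cocycle_not_Star[OF l] by blast
    show ?thesis
      unfolding eq Ker_d2_star_iff[OF p_odd(1) lam]
      using form_C2[OF p_odd(1) l] form_invariant[OF p_odd two_neq_zero l]
        star_form_property[OF char form_C2[OF p_odd(1) l] form_top[OF p_odd two_neq_zero l]]
      by (auto simp: star_form_def)
  qed
qed

lemma coord_cocycle:
  assumes k: "k \<in> labels p" and l: "l \<in> labels p"
  shows "coord p k (cocycle p l) = (if k = l then 1 else 0 :: 'a)"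
proof (cases "\<exists>i. l = Star i")
  case True
  then obtain i where i: "l = Star i" "1 \<le> i" "i \<le> p" using l by (auto simp: labels_def)
  show ?thesis
  proof (cases k)
    case (Star j)
    then show ?thesis using i k bas_X_Leven[of j p] p_odd(1)
      by (auto simp: labels_def X_star_def bas_def power_0_left)
  qed (simp_all add: i)
next
  case False
  then have eq: "cocycle p l = (form p l, star_form p (form p l) :: 'a elt \<Rightarrow> 'a)"
    using cocycle_not_Star[OF l] by blast
  note F = form_bas[OF two_neq_zero l]
  have gens: "m \<in> {1..(p - 1) div 2} \<Longrightarrow> 2 * m + 1 \<le> p" "m \<in> {1..(p + 1) div 2} \<Longrightarrow> 2 * m - 1 \<le> p"
    "m \<in> {2..p} \<Longrightarrow> Suc 0 \<le> m - Suc 0 \<and> m - Suc 0 \<le> p" for m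
    using p_odd by (auto elim!: oddE)
  have "coord p k (cocycle p l) = (case k of
      XXtop \<Rightarrow> entry p l (X 1) (X p) | XYtop \<Rightarrow> entry p l (X 1) (Y p)
    | XXsum m \<Rightarrow> entry p l (X 2) (X (2 * m + 1)) | XYsum j \<Rightarrow> entry p l (X 2) (Y (j - 1))
    | YYsum m \<Rightarrow> - entry p l (Y 1) (Y (2 * m - 1)) | Star i \<Rightarrow> (0 :: 'a))"
    using k p_odd gens by (cases k) (auto simp: eq F labels_def star_form_bas)
  \<comment> \<open>A first-row position determines its antidiagonal, so it meets only the form with
    its own label.\<close>
  also have "\<dots> = (if k = l then 1 else 0)"
    using k l p_odd False by (cases k; cases l) (auto simp: labels_def)
  finally show ?thesis .
qed

text \<open>If all coordinates vanish, the form lives only on pairs involving X_1. There a 1-cochain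
  is chosen to match it, and the vanishing \<open>Star\<close> coordinates leave zero as the second
  component.\<close>

lemma Im_d1_star_eq:
  "Im_d1_star p lam = {c \<in> Ker_d2_star p lam. \<forall>l\<in>labels p. coord p l c = (0 :: 'a)}"
proof (intro Set.set_eqI iffI)
  fix c assume "c \<in> Im_d1_star p lam"
  then obtain f where f: "f \<in> C1 p" and c: "c = d1_star p lam f" by (auto simp: Im_d1_star_def)
  have p1: "p \<ge> 1" using p_odd by simp
  have d1: "d1 p f (bas a) (bas b) = 0" if "a \<in> gens p" "b \<in> gens p"
    "a = X 1 \<and> (b = X p \<or> b = Y p) \<or> a \<noteq> X 1 \<and> b \<noteq> X 1" for a b
  proof -
    have X1: "bas g (X 1) = (if g = X 1 then 1 else 0 :: 'a)" for g by (auto simp: bas_def)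
    have p1': "p \<noteq> 1" using p_odd by simp
    show ?thesis
      using that p1' unfolding d1_eq[OF p1 f bas_Lpp[THEN iffD2, OF that(1)] bas_Lpp[THEN iffD2, OF that(2)]] X1
      by (auto simp: C1_zero[OF f])
  qed
  have gens: "m \<in> {1..(p - 1) div 2} \<Longrightarrow> 2 * m + 1 \<le> p" "m \<in> {1..(p + 1) div 2} \<Longrightarrow> 2 * m - 1 \<le> p" for m
    using p_odd by (auto elim!: oddE)
  have "coord p l c = 0" if "l \<in> labels p" for l
    using that p_odd gens unfolding c d1_star_def ind1_zero[OF f lam]
    by (cases l) (auto simp: labels_def intro!: d1)
  then show "c \<in> {c \<in> Ker_d2_star p lam. \<forall>l\<in>labels p. coord p l c = 0}"
    using d1_star_Ker[OF p_odd(1) lam f] c by blast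
next
  fix c assume c: "c \<in> {c \<in> Ker_d2_star p lam. \<forall>l\<in>labels p. coord p l c = (0 :: 'a)}"
  obtain \<phi> \<omega> where c_eq: "c = (\<phi>, \<omega>)" by fastforce
  have Ker: "(\<phi>, \<omega>) \<in> Ker_d2_star p lam" and coord: "\<And>l. l \<in> labels p \<Longrightarrow> coord p l (\<phi>, \<omega>) = 0"
    using c c_eq by auto
  note K = Ker[unfolded Ker_d2_star_iff[OF p_odd(1) lam]]
  have \<phi>: "\<phi> \<in> C2 p" using K by blast
  have p1: "p \<ge> 1" using p_odd by simp
  have zero: "\<phi> (bas a) (bas b) = 0" if "a \<in> gens p - {X 1}" "b \<in> gens p - {X 1}" for a b
  proof (rule invariant_form_zero[OF p_odd(1) two_neq_zero \<phi> _ _ _ _ that])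
    show "lieX1 p \<phi> (bas a) (bas b) = 0" if "a \<in> gens p - {X 1}" "b \<in> gens p - {X 1}" for a b
      using K that by blast
    show "\<phi> (bas (X 2)) (bas (X s)) = 0" if s: "odd s" "3 \<le> s" "s \<le> p" for s
    proof -
      from s obtain m where "s = 2 * m + 1" by (elim oddE)
      then show ?thesis using coord[of "XXsum m"] s by (auto simp: labels_def)
    qed
    show "\<phi> (bas (X 2)) (bas (Y t)) = 0" if "1 \<le> t" "t < p" for t
      using coord[of "XYsum (Suc t)"] that by (auto simp: labels_def)
    show "\<phi> (bas (Y 1)) (bas (Y t)) = 0" if t: "odd t" "t \<le> p" for t
    proof -
      from t obtain m where "t = 2 * m + 1" by (elim oddE)
      then show ?thesis using coord[of "YYsum (Suc m)"] t by (auto simp: labels_def)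
    qed
  qed
  \<comment> \<open>The equation d1 f (X_1, b) = - f (D b) dictates the value of \<open>f\<close> at
    each D b, whence the index i - 1. X_1, X_2 and Y_1 are not of this form and get the value
    0.\<close>
  define h where "h a = (case a of X i \<Rightarrow> if 3 \<le> i then - \<phi> (bas (X 1)) (bas (X (i - 1))) else 0
    | Y i \<Rightarrow> if 2 \<le> i then - \<phi> (bas (X 1)) (bas (Y (i - 1))) else 0)" for a
  define f where "f x = (if x \<in> Lpp p then \<Sum>a\<in>gens p. x a * h a else 0)" for x
  have f: "f \<in> C1 p" unfolding f_def[abs_def] by (rule C1_I)
  have f_bas: "f (bas a) = h a" if "a \<in> gens p" for a
    using that by (simp add: f_def sum_gens_bas)
  have d1C2: "d1 p f \<in> C2 p" by (rule d1_C2[OF p1 f])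
  have X1: "bas g (X 1) = (if g = X 1 then 1 else 0 :: 'a)" for g by (auto simp: bas_def)
  have "\<phi> = d1 p f"
  proof (rule C2_eqI[OF \<phi> d1C2])
    fix a b assume ab: "a \<in> gens p" "b \<in> gens p"
    have first: "\<phi> (bas (X 1)) (bas b) = d1 p f (bas (X 1)) (bas b)" if b: "b \<in> gens p" for b
    proof -
      have X11: "\<phi> (bas (X 1)) (bas (X 1)) = 0"
        using C2_bas_skew[OF \<phi>, of "X 1" "X 1"] p1 by (intro eq_neg_self[OF two_neq_zero]) simp
      have top: "\<phi> (bas (X 1)) (bas (X p)) = 0" "\<phi> (bas (X 1)) (bas (Y p)) = 0"
        using coord[of XXtop] coord[of XYtop] by (auto simp: labels_def)
      have "d1 p f (bas (X 1)) (bas b) = (if b = X 1 then 1 else 0) * f (adX1 p (bas (X 1))) - f (adX1 p (bas b))"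
        using d1_eq[OF p1 f, of "bas (X 1)" "bas b"] b p1 by (simp add: X1[simplified])
      also have "\<dots> = - f (adX1 p (bas b))" by (simp add: C1_zero[OF f])
      also have "\<dots> = \<phi> (bas (X 1)) (bas b)"
      proof (cases b)
        case (X i)
        then consider "i = 1" | "2 \<le> i" "i < p" | "i = p" using b by fastforce
        then show ?thesis using X X11 top by cases (auto simp: C1_zero[OF f] f_bas h_def)
      next
        case (Y i)
        then consider "1 \<le> i" "i < p" | "i = p" using b by fastforce
        then show ?thesis using Y top by cases (auto simp: C1_zero[OF f] f_bas h_def)
      qed
      finally show ?thesis by simp
    qed
    show "\<phi> (bas a) (bas b) = d1 p f (bas a) (bas b)"
    proof (cases "a = X 1 \<or> b = X 1")
      case True
      then show ?thesis
        using first[OF ab(1)] first[OF ab(2)] C2_bas_skew[OF \<phi> ab] C2_bas_skew[OF d1C2 ab] by auto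
    next
      case False
      have "d1 p f (bas a) (bas b) = 0"
        using False ab by (subst d1_eq[OF p1 f]) (simp_all add: X1[simplified])
      then show ?thesis using zero[of a b] False ab by simp
    qed
  qed
  moreover have "\<omega> = ind1 p lam f"
  proof (rule star_property_unique[OF p1])
    show "star_property p \<phi> \<omega>" "\<forall>x. x \<notin> Leven p \<longrightarrow> \<omega> x = 0" using K by blast+
    show "star_property p \<phi> (ind1 p lam f)"
      using d1_star_Ker[OF p_odd(1) lam f] unfolding d1_star_def Ker_d2_star_iff[OF p_odd(1) lam] \<open>\<phi> = d1 p f\<close> by blast
    show "\<forall>x. x \<notin> Leven p \<longrightarrow> ind1 p lam f x = 0" by (simp add: ind1_def)
    show "\<forall>i\<in>{1..p}. \<omega> (bas (X i)) = ind1 p lam f (bas (X i))"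
      using coord[of "Star _"] by (auto simp: labels_def ind1_zero[OF f lam])
  qed
  ultimately show "c \<in> Im_d1_star p lam"
    using f by (auto simp: c_eq Im_d1_star_def d1_star_def)
qed

end

theorem theorem4p3:
  fixes p :: nat and lam :: "nat \<Rightarrow> 'a::alg_closed_field"
  assumes "CHAR('a) = p" and "p > 2"
    and "\<forall>k\<in>{1..p}. lam k = 0"
  shows "vectorspace class_ring (H2_star p lam)
    \<and> vectorspace.dim class_ring (H2_star p lam) = 3 * p + 1
    \<and> cocycle_list p \<subseteq> Ker_d2_star p lam
    \<and> vectorspace.basis class_ring (H2_star p lam) (coh_class p lam ` cocycle_list p)"
proof -
  let ?M = "C2_star_space p\<lparr>carrier := Ker_d2_star p lam\<rparr>"
  have p3: "p \<ge> 3" and odd: "odd p" using CHAR_gt_2[OF assms(1,2)] by simp_all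
  note basis = quotient_dual_family_basis[of class_ring ?M "Im_d1_star p lam" "labels p" "coord p" "cocycle p"]
  have family: "vectorspace class_ring ?M"
    "Im_d1_star p lam = {v \<in> carrier ?M. \<forall>l\<in>labels p. coord p l v = \<zero>\<^bsub>class_ring\<^esub>}"
    "finite (labels p)" "cocycle p \<in> labels p \<rightarrow> carrier ?M"
    "\<And>l. l \<in> labels p \<Longrightarrow> coord p l \<in> carrier ?M \<rightarrow> carrier class_ring"
    using Ker_vectorspace[OF p3 assms(3)] Im_d1_star_eq[OF assms] finite_labels cocycle_Ker[OF assms]
    by (simp_all)
  have linear: "\<And>l v w. coord p l (v \<oplus>\<^bsub>?M\<^esub> w) = coord p l v \<oplus>\<^bsub>class_ring\<^esub> coord p l w"
    "\<And>l c v. coord p l (c \<odot>\<^bsub>?M\<^esub> v) = c \<otimes>\<^bsub>class_ring\<^esub> coord p l v"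
    by (case_tac l; simp add: C2_star_space_def split: prod.split)+
  have dual: "\<And>k l. k \<in> labels p \<Longrightarrow> l \<in> labels p \<Longrightarrow>
      coord p k (cocycle p l) = (if k = l then \<one>\<^bsub>class_ring\<^esub> else \<zero>\<^bsub>class_ring\<^esub> :: 'a)"
    using coord_cocycle[OF assms] by simp
  note B = basis[OF family linear dual]
  \<comment> \<open>A coset depends on the addition only, so restricting the carrier to the cocycles
    does not change it.\<close>
  have "coh_class p lam c = Im_d1_star p lam +>\<^bsub>?M\<^esub> c" for c
    by (simp add: coh_class_def a_r_coset_def')
  then have "coh_class p lam ` cocycle_list p = (\<lambda>l. Im_d1_star p lam +>\<^bsub>?M\<^esub> cocycle p l) ` labels p"
    unfolding cocycle_labels[OF odd, symmetric] by (simp add: image_image)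
  moreover have "cocycle_list p \<subseteq> Ker_d2_star p lam"
    unfolding cocycle_labels[OF odd, symmetric] using cocycle_Ker[OF assms] by blast
  ultimately show ?thesis
    using B card_labels[OF odd] by (simp add: H2_star_def)
qed


end
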